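(* Assume $T$ satisfies (LB). Every parametrically definable subset of $\mathbb U$ is a Boolean combination of intervals and classes of definable almost convex equivalence relations.
   Context: $T$ is a complete $L$-theory ($L\ni<$) with infinite models in which $<$ is a linear order; $\mathbb U$ is a monster model of $T$; "definable" means $L$-definable without parameters, parametrically definable means definable with parameters from $\mathbb U$. (LB): for all increasing sequences $a_1<\dots<a_n$ of elements of a model of $T$, $\bigcup_{1\le i<n}\mathrm{tp}_{x_i,x_{i+1}}(a_i,a_{i+1})\vdash\mathrm{tp}_{x_1,\dots,x_n}(a_1,\dots,a_n)$. An equivalence relation $R$ on a linearly ordered set is almost convex if there is a convex equivalence relation $E$ coarser than $R$ such that $R$ splits each $E$-class into finitely many classes. *)

theory Defs
  imports Main
begin

unbundle cardinal_syntax

text \<open>A language assigns an arity to each of its symbols; symbols mapped to \<open>None\<close> do not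
  belong to it.\<close>

record ('f, 'r) language =
  funs :: "'f \<rightharpoonup> nat"
  rels :: "'r \<rightharpoonup> nat"

datatype 'f tm = Var nat | App 'f "'f tm list"

datatype ('f, 'r) fm =
    Eq "'f tm" "'f tm"
  | Rel 'r "'f tm list"
  | Neg "('f, 'r) fm"
  | And "('f, 'r) fm" "('f, 'r) fm"
  | Ex nat "('f, 'r) fm"

fun fv_tm :: "'f tm \<Rightarrow> nat set" where
  "fv_tm (Var i) = {i}"
| "fv_tm (App f ts) = (\<Union>t\<in>set ts. fv_tm t)"

fun fv :: "('f, 'r) fm \<Rightarrow> nat set" where
  "fv (Eq s t) = fv_tm s \<union> fv_tm t"
| "fv (Rel r ts) = (\<Union>t\<in>set ts. fv_tm t)"
| "fv (Neg \<phi>) = fv \<phi>"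
| "fv (And \<phi> \<psi>) = fv \<phi> \<union> fv \<psi>"
| "fv (Ex i \<phi>) = fv \<phi> - {i}"

fun wf_tm :: "('f, 'r) language \<Rightarrow> 'f tm \<Rightarrow> bool" where
  "wf_tm L (Var i) = True"
| "wf_tm L (App f ts) = (funs L f = Some (length ts) \<and> (\<forall>t\<in>set ts. wf_tm L t))"

fun wf_fm :: "('f, 'r) language \<Rightarrow> ('f, 'r) fm \<Rightarrow> bool" where
  "wf_fm L (Eq s t) = (wf_tm L s \<and> wf_tm L t)"
| "wf_fm L (Rel r ts) = (rels L r = Some (length ts) \<and> (\<forall>t\<in>set ts. wf_tm L t))"
| "wf_fm L (Neg \<phi>) = wf_fm L \<phi>"
| "wf_fm L (And \<phi> \<psi>) = (wf_fm L \<phi> \<and> wf_fm L \<psi>)"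
| "wf_fm L (Ex i \<phi>) = wf_fm L \<phi>"

definition formulas :: "('f, 'r) language \<Rightarrow> ('f, 'r) fm set" where
  "formulas L = {\<phi>. wf_fm L \<phi>}"

definition sentences :: "('f, 'r) language \<Rightarrow> ('f, 'r) fm set" where
  "sentences L = {\<phi>. wf_fm L \<phi> \<and> fv \<phi> = {}}"

record ('f, 'r, 'u) struct =
  dom :: "'u set"
  fn_int :: "'f \<Rightarrow> 'u list \<Rightarrow> 'u"
  rel_int :: "'r \<Rightarrow> 'u list \<Rightarrow> bool"

hide_const (open) Map.dom

definition is_struct :: "('f, 'r) language \<Rightarrow> ('f, 'r, 'u) struct \<Rightarrow> bool" where
  "is_struct L M \<longleftrightarrow> dom M \<noteq> {} \<and>
     (\<forall>f as. funs L f = Some (length as) \<and> set as \<subseteq> dom M \<longrightarrow> fn_int M f as \<in> dom M)"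

fun val :: "('f, 'r, 'u) struct \<Rightarrow> (nat \<Rightarrow> 'u) \<Rightarrow> 'f tm \<Rightarrow> 'u" where
  "val M e (Var i) = e i"
| "val M e (App f ts) = fn_int M f (map (val M e) ts)"

fun sat :: "('f, 'r, 'u) struct \<Rightarrow> (nat \<Rightarrow> 'u) \<Rightarrow> ('f, 'r) fm \<Rightarrow> bool" where
  "sat M e (Eq s t) = (val M e s = val M e t)"
| "sat M e (Rel r ts) = rel_int M r (map (val M e) ts)"
| "sat M e (Neg \<phi>) = (\<not> sat M e \<phi>)"
| "sat M e (And \<phi> \<psi>) = (sat M e \<phi> \<and> sat M e \<psi>)"
| "sat M e (Ex i \<phi>) = (\<exists>u\<in>dom M. sat M (e(i := u)) \<phi>)"

text \<open>HOL cannot quantify over all models of a theory, whatever type their elements come from.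
  Notions that refer to all models carry a type argument \<open>'u itself\<close> and range over all structures
  whose domain is an arbitrary subset of \<open>'u\<close>. When \<open>'u\<close> is infinite and contains at least
  \<open>|formulas L|\<close> elements, nothing is lost, by the downward Loewenheim-Skolem theorem.\<close>

definition model :: "('f, 'r) language \<Rightarrow> ('f, 'r) fm set \<Rightarrow> ('f, 'r, 'u) struct \<Rightarrow> bool" where
  "model L T M \<longleftrightarrow> is_struct L M \<and> (\<forall>\<phi>\<in>T. \<forall>e. range e \<subseteq> dom M \<longrightarrow> sat M e \<phi>)"

text \<open>\<open>entails TYPE('u) L T \<Gamma> \<Delta>\<close>: modulo \<open>T\<close>, the set \<open>\<Gamma>\<close> of formulas implies every member of
  \<open>\<Delta>\<close>; free variables are shared between \<open>\<Gamma>\<close> and \<open>\<Delta>\<close>.\<close>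

definition entails ::
  "'u itself \<Rightarrow> ('f, 'r) language \<Rightarrow> ('f, 'r) fm set \<Rightarrow> ('f, 'r) fm set \<Rightarrow> ('f, 'r) fm set \<Rightarrow> bool"
where
  "entails (_ :: 'u itself) L T \<Gamma> \<Delta> \<longleftrightarrow>
     (\<forall>(N :: ('f, 'r, 'u) struct) e. model L T N \<and> range e \<subseteq> dom N \<and> (\<forall>\<phi>\<in>\<Gamma>. sat N e \<phi>)
        \<longrightarrow> (\<forall>\<psi>\<in>\<Delta>. sat N e \<psi>))"

definition complete_theory :: "'u itself \<Rightarrow> ('f, 'r) language \<Rightarrow> ('f, 'r) fm set \<Rightarrow> bool" where
  "complete_theory (ty :: 'u itself) L T \<longleftrightarrow>
     T \<subseteq> sentences L \<and> (\<exists>M :: ('f, 'r, 'u) struct. model L T M) \<and>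
     (\<forall>\<phi>\<in>sentences L. entails ty L T {} {\<phi>} \<or> entails ty L T {} {Neg \<phi>})"

text \<open>\<open>tp L M X a\<close> is the complete type in the variables \<open>x\<^sub>i\<close>, \<open>i \<in> X\<close>, of the tuple
  \<open>(a i)\<^bsub>i \<in> X\<^esub>\<close>; the values of \<open>a\<close> outside \<open>X\<close> are irrelevant.\<close>

definition tp ::
  "('f, 'r) language \<Rightarrow> ('f, 'r, 'u) struct \<Rightarrow> nat set \<Rightarrow> (nat \<Rightarrow> 'u) \<Rightarrow> ('f, 'r) fm set" where
  "tp L M X a = {\<phi> \<in> formulas L. fv \<phi> \<subseteq> X \<and> sat M a \<phi>}"

abbreviation less_in :: "('f, 'r, 'u) struct \<Rightarrow> 'r \<Rightarrow> 'u \<Rightarrow> 'u \<Rightarrow> bool" where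
  "less_in M lt x y \<equiv> rel_int M lt [x, y]"

definition linear_order_theory ::
  "'u itself \<Rightarrow> ('f, 'r) language \<Rightarrow> 'r \<Rightarrow> ('f, 'r) fm set \<Rightarrow> bool" where
  "linear_order_theory (_ :: 'u itself) L lt T \<longleftrightarrow>
     (\<forall>M :: ('f, 'r, 'u) struct. model L T M \<longrightarrow>
        irreflp_on (dom M) (less_in M lt) \<and> transp_on (dom M) (less_in M lt) \<and>
        totalp_on (dom M) (less_in M lt))"

text \<open>The bound \<open>n \<ge> 2\<close> is needed: for \<open>n = 1\<close> the union is empty, and the condition would say that
  \<open>T\<close> has only one 1-type.\<close>

definition LB :: "'u itself \<Rightarrow> ('f, 'r) language \<Rightarrow> 'r \<Rightarrow> ('f, 'r) fm set \<Rightarrow> bool" where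
  "LB (ty :: 'u itself) L lt T \<longleftrightarrow>
     (\<forall>(M :: ('f, 'r, 'u) struct) n a. model L T M \<and> n \<ge> 2 \<and> a ` {1..n} \<subseteq> dom M \<and>
        (\<forall>i\<in>{1..<n}. less_in M lt (a i) (a (Suc i)))
        \<longrightarrow> entails ty L T (\<Union>i\<in>{1..<n}. tp L M {i, Suc i} a) (tp L M {1..n} a))"

text \<open>A formula with parameters from \<open>A\<close> in the variable \<open>x\<^sub>0\<close> is a formula together with an
  assignment of elements of \<open>A\<close> to its other free variables.\<close>

definition param_formulas ::
  "('f, 'r) language \<Rightarrow> 'u set \<Rightarrow> (('f, 'r) fm \<times> (nat \<Rightarrow> 'u)) set" where
  "param_formulas L A = {(\<phi>, e). \<phi> \<in> formulas L \<and> e ` (fv \<phi> - {0}) \<subseteq> A}"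

definition realizes ::
  "('f, 'r, 'u) struct \<Rightarrow> 'u \<Rightarrow> (('f, 'r) fm \<times> (nat \<Rightarrow> 'u)) set \<Rightarrow> bool" where
  "realizes M u p \<longleftrightarrow> u \<in> dom M \<and> (\<forall>(\<phi>, e)\<in>p. sat M (e(0 := u)) \<phi>)"

definition saturated ::
  "('f, 'r) language \<Rightarrow> 'k rel \<Rightarrow> ('f, 'r, 'u) struct \<Rightarrow> bool" where
  "saturated L \<kappa> M \<longleftrightarrow>
     (\<forall>A p. A \<subseteq> dom M \<and> |A| <o \<kappa> \<and> p \<subseteq> param_formulas L A \<and>
        (\<forall>q. q \<subseteq> p \<and> finite q \<longrightarrow> (\<exists>u. realizes M u q))
        \<longrightarrow> (\<exists>u. realizes M u p))"

definition elementary_map ::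
  "('f, 'r) language \<Rightarrow> ('f, 'r, 'u) struct \<Rightarrow> 'u set \<Rightarrow> ('u \<Rightarrow> 'u) \<Rightarrow> bool" where
  "elementary_map L M A h \<longleftrightarrow> A \<subseteq> dom M \<and> h ` A \<subseteq> dom M \<and>
     (\<forall>\<phi>\<in>formulas L. \<forall>e. e ` fv \<phi> \<subseteq> A \<longrightarrow> (sat M e \<phi> \<longleftrightarrow> sat M (h \<circ> e) \<phi>))"

definition automorphism ::
  "('f, 'r) language \<Rightarrow> ('f, 'r, 'u) struct \<Rightarrow> ('u \<Rightarrow> 'u) \<Rightarrow> bool" where
  "automorphism L M g \<longleftrightarrow> bij_betw g (dom M) (dom M) \<and>
     (\<forall>f as. funs L f = Some (length as) \<and> set as \<subseteq> dom M
        \<longrightarrow> g (fn_int M f as) = fn_int M f (map g as)) \<and>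
     (\<forall>r as. rels L r = Some (length as) \<and> set as \<subseteq> dom M
        \<longrightarrow> (rel_int M r as \<longleftrightarrow> rel_int M r (map g as)))"

definition strongly_homogeneous ::
  "('f, 'r) language \<Rightarrow> 'k rel \<Rightarrow> ('f, 'r, 'u) struct \<Rightarrow> bool" where
  "strongly_homogeneous L \<kappa> M \<longleftrightarrow>
     (\<forall>A h. |A| <o \<kappa> \<and> elementary_map L M A h
        \<longrightarrow> (\<exists>g. automorphism L M g \<and> (\<forall>a\<in>A. g a = h a)))"

text \<open>\<open>|formulas L|\<close> is \<open>|L| + \<aleph>\<^sub>0\<close>.\<close>

definition monster_model ::
  "('f, 'r) language \<Rightarrow> ('f, 'r) fm set \<Rightarrow> 'k rel \<Rightarrow> ('f, 'r, 'u) struct \<Rightarrow> bool" where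
  "monster_model L T \<kappa> U \<longleftrightarrow> model L T U \<and> Card_order \<kappa> \<and> |formulas L| <o \<kappa> \<and>
     saturated L \<kappa> U \<and> strongly_homogeneous L \<kappa> U"

definition param_definable_set ::
  "('f, 'r) language \<Rightarrow> ('f, 'r, 'u) struct \<Rightarrow> 'u set \<Rightarrow> bool" where
  "param_definable_set L M D \<longleftrightarrow>
     (\<exists>(\<phi>, e)\<in>param_formulas L (dom M). D = {u \<in> dom M. sat M (e(0 := u)) \<phi>})"

text \<open>Definable without parameters; \<open>e\<close> is a dummy because all free variables are overwritten.\<close>

definition definable_rel ::
  "('f, 'r) language \<Rightarrow> ('f, 'r, 'u) struct \<Rightarrow> 'u rel \<Rightarrow> bool" where
  "definable_rel L M R \<longleftrightarrow>
     (\<exists>\<phi>\<in>formulas L. fv \<phi> \<subseteq> {0, 1} \<and>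
        (\<forall>e. R = {(u, v). u \<in> dom M \<and> v \<in> dom M \<and> sat M (e(0 := u, 1 := v)) \<phi>}))"

text \<open>From here on, \<open>X\<close> is a set and \<open>lt\<close> a strict linear order on it.\<close>

definition convex_in :: "'a set \<Rightarrow> ('a \<Rightarrow> 'a \<Rightarrow> bool) \<Rightarrow> 'a set \<Rightarrow> bool" where
  "convex_in X lt C \<longleftrightarrow> C \<subseteq> X \<and> (\<forall>x\<in>C. \<forall>y\<in>C. \<forall>z\<in>X. lt x z \<and> lt z y \<longrightarrow> z \<in> C)"

definition convex_equiv :: "'a set \<Rightarrow> ('a \<Rightarrow> 'a \<Rightarrow> bool) \<Rightarrow> 'a rel \<Rightarrow> bool" where
  "convex_equiv X lt E \<longleftrightarrow> equiv X E \<and> (\<forall>C\<in>X // E. convex_in X lt C)"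

definition almost_convex_equiv :: "'a set \<Rightarrow> ('a \<Rightarrow> 'a \<Rightarrow> bool) \<Rightarrow> 'a rel \<Rightarrow> bool" where
  "almost_convex_equiv X lt R \<longleftrightarrow> equiv X R \<and>
     (\<exists>E. convex_equiv X lt E \<and> R \<subseteq> E \<and> (\<forall>C\<in>X // E. finite {D \<in> X // R. D \<subseteq> C}))"

text \<open>Intervals are open, closed or half-open, with endpoints in \<open>X \<union> {-\<infinity>, \<infinity>}\<close>; in
  particular \<open>X\<close> itself and all rays are intervals.\<close>

definition upward_rays :: "'a set \<Rightarrow> ('a \<Rightarrow> 'a \<Rightarrow> bool) \<Rightarrow> 'a set set" where
  "upward_rays X lt =
     {X} \<union> {{x \<in> X. lt a x} |a. a \<in> X} \<union> {{x \<in> X. a = x \<or> lt a x} |a. a \<in> X}"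

definition downward_rays :: "'a set \<Rightarrow> ('a \<Rightarrow> 'a \<Rightarrow> bool) \<Rightarrow> 'a set set" where
  "downward_rays X lt =
     {X} \<union> {{x \<in> X. lt x b} |b. b \<in> X} \<union> {{x \<in> X. x = b \<or> lt x b} |b. b \<in> X}"

definition intervals :: "'a set \<Rightarrow> ('a \<Rightarrow> 'a \<Rightarrow> bool) \<Rightarrow> 'a set set" where
  "intervals X lt = {A \<inter> B |A B. A \<in> upward_rays X lt \<and> B \<in> downward_rays X lt}"

inductive_set boolean_combinations :: "'a set \<Rightarrow> 'a set set \<Rightarrow> 'a set set"
  for X :: "'a set" and G :: "'a set set" where
  gen: "S \<in> G \<Longrightarrow> S \<in> boolean_combinations X G"
| compl: "S \<in> boolean_combinations X G \<Longrightarrow> X - S \<in> boolean_combinations X G"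
| inter: "S \<in> boolean_combinations X G \<Longrightarrow> S' \<in> boolean_combinations X G
    \<Longrightarrow> S \<inter> S' \<in> boolean_combinations X G"
| union: "S \<in> boolean_combinations X G \<Longrightarrow> S' \<in> boolean_combinations X G
    \<Longrightarrow> S \<union> S' \<in> boolean_combinations X G"

definition definable_almost_convex_classes ::
  "('f, 'r) language \<Rightarrow> 'r \<Rightarrow> ('f, 'r, 'u) struct \<Rightarrow> 'u set set" where
  "definable_almost_convex_classes L lt M =
     {C. \<exists>R. definable_rel L M R \<and> almost_convex_equiv (dom M) (less_in M lt) R \<and> C \<in> dom M // R}"

end

theory Submission imports Defs begin

text \<open>By (LB) and saturation, a definable set is a Boolean combination of sets defined over a single
  parameter \<open>a\<close> on one side of \<open>a\<close>, say \<open>{x. a < x \<and> f a x}\<close>. Again by (LB) and saturation, across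
  every cut only finitely many traces occur: for \<open>c < x\<close> the rank of \<open>(c, x)\<close>, the number of sets
  \<open>{t. x \<le> t \<and> f u t}\<close> with \<open>u \<le> c\<close>, is finite; it increases with \<open>c\<close> and decreases with \<open>x\<close>.
  Where the rank is constant, restricting traces to a later point loses nothing, so points \<open>x, y\<close>
  such that some \<open>c\<close> has rank \<open>r\<close> with both form classes of a convex equivalence relation; requiring
  moreover that \<open>f u x \<longleftrightarrow> f u y\<close> for all \<open>u \<le> c\<close> splits each class into at most \<open>2\<^sup>r\<close> pieces. Both
  relations are definable without parameters. For fixed \<open>a\<close> the rank of \<open>(a, x)\<close> takes finitely many
  values, which cuts the ray above \<open>a\<close> into finitely many convex pieces, and on each piece
  \<open>f a x\<close> depends only on the class of \<open>x\<close>.\<close>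

section \<open>Boolean combinations\<close>

lemma boolean_combinations_empty:
  assumes "X \<in> boolean_combinations X G"
  shows "{} \<in> boolean_combinations X G"
  using boolean_combinations.compl[OF assms] by simp

lemma boolean_combinations_Inter:
  assumes "finite F" "F \<subseteq> boolean_combinations X G" "X \<in> boolean_combinations X G"
  shows "X \<inter> \<Inter>F \<in> boolean_combinations X G"
  using assms(1,2)
proof (induction F)
  case empty
  then show ?case using assms(3) by simp
next
  case (insert S F)
  have "X \<inter> \<Inter>(insert S F) = S \<inter> (X \<inter> \<Inter>F)" by auto
  then show ?case using insert boolean_combinations.inter[of S X G] by auto
qed

lemma boolean_combinations_Union:
  assumes "finite F" "F \<subseteq> boolean_combinations X G" "X \<in> boolean_combinations X G"
  shows "\<Union>F \<in> boolean_combinations X G"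
  using assms(1,2)
proof (induction F)
  case empty
  then show ?case using boolean_combinations_empty[OF assms(3)] by simp
next
  case (insert S F)
  then show ?case using boolean_combinations.union[of S X G] by auto
qed

lemma boolean_combinations_diff:
  assumes "S \<in> boolean_combinations X G" "S' \<in> boolean_combinations X G" "S \<subseteq> X"
  shows "S - S' \<in> boolean_combinations X G"
proof -
  have "S - S' = S \<inter> (X - S')" using assms(3) by auto
  then show ?thesis
    using assms boolean_combinations.compl boolean_combinations.inter by metis
qed

lemma boolean_combinations_trans:
  assumes "S \<in> boolean_combinations X G" "G \<subseteq> boolean_combinations X H"
  shows "S \<in> boolean_combinations X H"
  using assms(1)
  by induction (use assms(2) in \<open>auto intro: boolean_combinations.intros\<close>)

section \<open>Relations with finitely many traces across each cut\<close>

text \<open>Only an order and a finiteness condition enter here, no logic, so the results also apply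
  to the reversed order.\<close>

locale finite_cuts =
  fixes X :: "'a set" and lt :: "'a \<Rightarrow> 'a \<Rightarrow> bool" and f :: "'a \<Rightarrow> 'a \<Rightarrow> bool"
  assumes irrefl: "irreflp_on X lt"
    and trans: "transp_on X lt"
    and total: "totalp_on X lt"
    and finite_cut: "a \<in> X \<Longrightarrow> finite ((\<lambda>u. {t \<in> X. lt a t \<and> f u t}) ` {u \<in> X. u = a \<or> lt u a})"
begin

text \<open>The ray is closed at \<open>x\<close> so that a trace records the truth value of
  \<open>f u x\<close>.\<close>

definition trace :: "'a \<Rightarrow> 'a \<Rightarrow> 'a set" where
  "trace x u = {t \<in> X. (t = x \<or> lt x t) \<and> f u t}"

definition down :: "'a \<Rightarrow> 'a set" where
  "down c = {u \<in> X. u = c \<or> lt u c}"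

abbreviation traces :: "'a \<Rightarrow> 'a \<Rightarrow> 'a set set" where
  "traces c x \<equiv> trace x ` down c"

text \<open>For \<open>c < x\<close> there are finitely many traces, so \<open>card\<close> is the
  true rank and not the value 0 given to infinite sets.\<close>

definition stable :: "nat \<Rightarrow> 'a \<Rightarrow> 'a \<Rightarrow> bool" where
  "stable r c x \<longleftrightarrow> c \<in> X \<and> x \<in> X \<and> lt c x \<and> card (traces c x) = r"

text \<open>The disjunct \<open>x = y\<close> makes a singleton class of each point that has no
  witness \<open>c\<close>.\<close>

definition coarse :: "nat \<Rightarrow> 'a rel" where
  "coarse r = {(x, y). x \<in> X \<and> y \<in> X \<and> (x = y \<or> (\<exists>c. stable r c x \<and> stable r c y))}"

text \<open>Lowering the witness \<open>c\<close> weakens the demand only in appearance: at a fixed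
  rank a lower witness already sees all traces, see \<open>stable_traces_eq\<close>.\<close>

definition fine :: "nat \<Rightarrow> 'a rel" where
  "fine r = {(x, y). x \<in> X \<and> y \<in> X \<and>
     (x = y \<or> (\<exists>c. stable r c x \<and> stable r c y \<and> (\<forall>u\<in>down c. f u x \<longleftrightarrow> f u y)))}"

lemma lt_irrefl: "x \<in> X \<Longrightarrow> \<not> lt x x"
  using irrefl by (simp add: irreflp_on_def)

lemma lt_trans: "lt x y \<Longrightarrow> lt y z \<Longrightarrow> x \<in> X \<Longrightarrow> y \<in> X \<Longrightarrow> z \<in> X \<Longrightarrow> lt x z"
  using trans unfolding transp_on_def by blast

lemma lt_cases: "x \<in> X \<Longrightarrow> y \<in> X \<Longrightarrow> x = y \<or> lt x y \<or> lt y x"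
  using total unfolding totalp_on_def by blast

section \<open>Traces and monotonicity of the rank\<close>

lemma down_mono:
  assumes "c \<in> X" "c' \<in> X" "c = c' \<or> lt c c'"
  shows "down c \<subseteq> down c'"
  using assms lt_trans unfolding down_def by blast

lemma trace_later:
  assumes "x \<in> X" "y \<in> X" "x = y \<or> lt x y"
  shows "trace y u = trace x u \<inter> {t. t = y \<or> lt y t}"
  using assms lt_trans unfolding trace_def by blast

lemma traces_later:
  assumes "x \<in> X" "y \<in> X" "x = y \<or> lt x y"
  shows "traces c y = (\<lambda>S. S \<inter> {t. t = y \<or> lt y t}) ` traces c x"
  using trace_later[OF assms] by (auto simp: image_image)

lemma traces_from_cut:
  assumes "c \<in> X" "x \<in> X" "lt c x"
  shows "traces c x =
    (\<lambda>S. S \<inter> {t. t = x \<or> lt x t}) ` (\<lambda>u. {t \<in> X. lt c t \<and> f u t}) ` {u \<in> X. u = c \<or> lt u c}"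
proof -
  have "trace x u = {t \<in> X. lt c t \<and> f u t} \<inter> {t. t = x \<or> lt x t}" for u
    using assms lt_trans unfolding trace_def by blast
  then show ?thesis by (auto simp: image_image down_def)
qed

lemma finite_traces:
  assumes "c \<in> X" "x \<in> X" "lt c x"
  shows "finite (traces c x)"
  unfolding traces_from_cut[OF assms] using finite_cut[OF assms(1)] by blast

text \<open>The traces at \<open>x\<close> are restrictions of the finitely many traces on the open
  ray above \<open>a\<close>, a family that does not depend on \<open>x\<close>.\<close>

lemma bounded_card_traces:
  assumes "a \<in> X"
  obtains N where "\<And>x. x \<in> X \<Longrightarrow> lt a x \<Longrightarrow> card (traces a x) \<le> N"
proof
  fix x assume "x \<in> X" "lt a x"
  then show "card (traces a x) \<le> card ((\<lambda>u. {t \<in> X. lt a t \<and> f u t}) ` {u \<in> X. u = a \<or> lt u a})"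
    unfolding traces_from_cut[OF assms \<open>x \<in> X\<close> \<open>lt a x\<close>]
    by (intro card_image_le finite_cut assms)
qed

lemma card_traces_later:
  assumes "c \<in> X" "x \<in> X" "y \<in> X" "lt c x" "x = y \<or> lt x y"
  shows "card (traces c y) \<le> card (traces c x)"
  unfolding traces_later[OF assms(2,3,5), of c]
  by (rule card_image_le[OF finite_traces[OF assms(1,2,4)]])

text \<open>The set of traces for the smaller of \<open>c\<close> and \<open>c'\<close> is contained
  in the other one; nested finite sets of the same size are equal.\<close>

lemma stable_traces_eq:
  assumes "stable r c x" "stable r c' x"
  shows "traces c x = traces c' x"
proof -
  have *: "traces c x = traces c' x"
    if "stable r c x" "stable r c' x" "c = c' \<or> lt c c'" for c c'
  proof (rule card_subset_eq)
    show "finite (traces c' x)" using that finite_traces unfolding stable_def by blast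
    show "traces c x \<subseteq> traces c' x"
      using that by (intro image_mono down_mono) (auto simp: stable_def)
    show "card (traces c x) = card (traces c' x)" using that unfolding stable_def by simp
  qed
  show ?thesis using *[OF assms] *[OF assms(2,1)] lt_cases[of c c'] assms
    unfolding stable_def by metis
qed

text \<open>A witness can be lowered. If \<open>y < x\<close>, the rank of \<open>(c, y)\<close>
  lies between those of \<open>(c, x)\<close> and \<open>(c', y)\<close>, both \<open>r\<close>.
  Otherwise \<open>c\<close> and \<open>c'\<close> have the same traces at \<open>x\<close>, hence
  after restriction also at \<open>y\<close>.\<close>

lemma stable_mono:
  assumes "stable r c x" "stable r c' x" "stable r c' y" "c = c' \<or> lt c c'"
  shows "stable r c y"
proof -
  have X: "c \<in> X" "c' \<in> X" "x \<in> X" "y \<in> X" "lt c x" "lt c' y"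
    using assms unfolding stable_def by auto
  then have "lt c y" using assms(4) lt_trans by blast
  have "card (traces c y) = r"
  proof (cases "lt y x")
    case True
    have "card (traces c y) \<le> card (traces c' y)"
      using X assms(4) by (intro card_mono finite_traces image_mono down_mono)
    moreover have "card (traces c x) \<le> card (traces c y)"
      using card_traces_later[of c y x] X True \<open>lt c y\<close> by blast
    ultimately show ?thesis using assms unfolding stable_def by simp
  next
    case False
    then have "x = y \<or> lt x y" using lt_cases X by blast
    from traces_later[OF X(3,4) this] have "traces c y = traces c' y"
      by (simp only: stable_traces_eq[OF assms(1,2)])
    then show ?thesis using assms unfolding stable_def by simp
  qed
  then show ?thesis using X \<open>lt c y\<close> unfolding stable_def by simp
qed

text \<open>The smaller of the two witnesses serves for all three points. This is what makes both
  relations transitive.\<close>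

lemma stable_common:
  assumes "stable r c x" "stable r c y" "stable r c' y" "stable r c' z"
  obtains d where "stable r d x" "stable r d y" "stable r d z" "down d \<subseteq> down c \<inter> down c'"
proof -
  have X: "c \<in> X" "c' \<in> X" using assms unfolding stable_def by auto
  consider "c = c' \<or> lt c c'" | "c' = c \<or> lt c' c" using lt_cases[OF X] by blast
  then show thesis
  proof cases
    case 1
    then show thesis
      using that[of c] stable_mono[OF assms(2,3,4)] assms down_mono X by blast
  next
    case 2
    then show thesis
      using that[of c'] stable_mono[OF assms(3,2,1)] assms down_mono X by blast
  qed
qed

text \<open>For \<open>x\<close> before \<open>y\<close>, restriction maps the \<open>r\<close>
  traces at \<open>x\<close> onto the \<open>r\<close> traces at \<open>y\<close>. A surjection
  between finite sets of equal size is injective, so no two traces merge.\<close>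

lemma stable_trace_eq_iff:
  assumes "stable r c x" "stable r c y" "u \<in> down c" "v \<in> down c"
  shows "trace x u = trace x v \<longleftrightarrow> trace y u = trace y v"
proof -
  have *: "trace x u = trace x v \<longleftrightarrow> trace y u = trace y v"
    if "stable r c x" "stable r c y" "x = y \<or> lt x y" for x y
  proof -
    have X: "c \<in> X" "x \<in> X" "y \<in> X" "lt c x" using that unfolding stable_def by auto
    let ?g = "\<lambda>S. S \<inter> {t. t = y \<or> lt y t}"
    have "card (?g ` traces c x) = card (traces c x)"
      using traces_later[OF X(2,3) that(3), of c] that unfolding stable_def by simp
    then have "inj_on ?g (traces c x)"
      using finite_traces X eq_card_imp_inj_on by blast
    then show ?thesis
      using trace_later[OF X(2,3) that(3)] assms(3,4) unfolding inj_on_def by auto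
  qed
  show ?thesis
    using *[OF assms(1,2)] *[OF assms(2,1)] lt_cases[of x y] assms(1,2)
    unfolding stable_def by blast
qed

lemma mem_trace_self: "x \<in> X \<Longrightarrow> x \<in> trace x u \<longleftrightarrow> f u x"
  unfolding trace_def by simp

section \<open>The two equivalence relations of a fixed rank\<close>

lemma equiv_coarse: "equiv X (coarse r)"
proof (rule equivI)
  show "coarse r \<subseteq> X \<times> X" by (auto simp: coarse_def)
  show "refl_on X (coarse r)" by (auto simp: refl_on_def coarse_def)
  show "sym (coarse r)" by (auto simp: sym_def coarse_def)
  show "Relation.trans (coarse r)"
  proof (rule transI)
    fix x y z assume "(x, y) \<in> coarse r" "(y, z) \<in> coarse r"
    then show "(x, z) \<in> coarse r"
      unfolding coarse_def using stable_common[of r _ x y _ z] by blast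
  qed
qed

lemma equiv_fine: "equiv X (fine r)"
proof (rule equivI)
  show "fine r \<subseteq> X \<times> X" by (auto simp: fine_def)
  show "refl_on X (fine r)" by (auto simp: refl_on_def fine_def)
  show "sym (fine r)" by (auto simp: sym_def fine_def)
  show "Relation.trans (fine r)"
  proof (rule transI)
    fix x y z assume *: "(x, y) \<in> fine r" "(y, z) \<in> fine r"
    show "(x, z) \<in> fine r"
    \<comment> \<open>The reflexive disjunct carries no witness and is treated apart.\<close>
    proof (cases "x = y \<or> y = z")
      case True
      then show ?thesis using * by auto
    next
      case False
      then obtain c c' where c: "stable r c x" "stable r c y" "stable r c' y" "stable r c' z"
        "\<forall>u\<in>down c. f u x \<longleftrightarrow> f u y" "\<forall>u\<in>down c'. f u y \<longleftrightarrow> f u z"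
        using * unfolding fine_def by blast
      obtain d where d: "stable r d x" "stable r d z" "down d \<subseteq> down c \<inter> down c'"
        using stable_common[OF c(1-4)] by blast
      then have "\<forall>u\<in>down d. f u x \<longleftrightarrow> f u z" using c(5,6) by blast
      then show ?thesis using d * unfolding fine_def by blast
    qed
  qed
qed

lemma fine_subset_coarse: "fine r \<subseteq> coarse r"
  unfolding fine_def coarse_def by blast

text \<open>The rank of \<open>(c, z)\<close> weakly decreases in \<open>z\<close>, so it is
  constant between two points of equal rank over the same \<open>c\<close>.\<close>

lemma convex_coarse: "convex_equiv X lt (coarse r)"
  unfolding convex_equiv_def convex_in_def
proof (intro conjI ballI impI equiv_coarse)
  fix C assume C: "C \<in> X // coarse r"
  show "C \<subseteq> X" using C equiv_coarse in_quotient_imp_subset by metis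
  fix x y z assume *: "x \<in> C" "y \<in> C" "z \<in> X" "lt x z \<and> lt z y"
  have X: "x \<in> X" "y \<in> X" using * \<open>C \<subseteq> X\<close> by auto
  have "(x, y) \<in> coarse r" using C * quotient_eq_iff[OF equiv_coarse] by blast
  moreover have "x \<noteq> y" using * X lt_trans lt_irrefl by blast
  ultimately obtain c where c: "stable r c x" "stable r c y" unfolding coarse_def by blast
  have cX: "c \<in> X" "lt c x" using c unfolding stable_def by auto
  then have cz: "lt c z" using * X lt_trans by blast
  have "card (traces c z) = r"
    using card_traces_later[of c x z] card_traces_later[of c z y] c cX cz X *
    unfolding stable_def by auto
  then have "stable r c z" using cX cz * unfolding stable_def by simp
  then have "(x, z) \<in> coarse r" using c X * unfolding coarse_def by blast
  then show "z \<in> C" using C * equiv_coarse in_quotient_imp_closed by metis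
qed

text \<open>On \<open>K\<close> the map \<open>g\<close> factors through \<open>h\<close>; choosing
  a point in each fibre of \<open>h\<close> gives the second factor.\<close>

lemma finite_image_of_finer:
  assumes "finite (h ` K)" "\<And>y z. y \<in> K \<Longrightarrow> z \<in> K \<Longrightarrow> h y = h z \<Longrightarrow> g y = g z"
  shows "finite (g ` K)"
proof -
  have "g y = g (SOME z. z \<in> K \<and> h z = h y)" if "y \<in> K" for y
    using that someI[of "\<lambda>z. z \<in> K \<and> h z = h y" y] assms(2) by metis
  then have "g ` K \<subseteq> (\<lambda>w. g (SOME z. z \<in> K \<and> h z = w)) ` h ` K" by auto
  then show ?thesis using assms(1) finite_surj by blast
qed

text \<open>Colour \<open>y\<close> by the traces at \<open>x\<close> of those parameters
  \<open>u\<close> up to a witness for which \<open>f u y\<close> holds. All witnesses have the same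
  \<open>r\<close> traces at \<open>x\<close>, so there are at most \<open>2^r\<close> colours, and
  equal colours force equal fine classes.\<close>

lemma finite_fine_classes:
  assumes "x \<in> X"
  shows "finite ((\<lambda>y. fine r `` {y}) ` (coarse r `` {x}))"
proof -
  \<comment> \<open>The point \<open>x\<close> may lack a witness; it contributes one class and is
    added back at the end.\<close>
  define K where "K = coarse r `` {x} - {x}"
  define w where "w y = (SOME c. stable r c x \<and> stable r c y)" for y
  have w: "stable r (w y) x" "stable r (w y) y" if "y \<in> K" for y
  proof -
    have "\<exists>c. stable r c x \<and> stable r c y" using that unfolding K_def coarse_def by auto
    then have "stable r (w y) x \<and> stable r (w y) y" unfolding w_def by (rule someI_ex)
    then show "stable r (w y) x" "stable r (w y) y" by auto
  qed
  define col where "col y = trace x ` {u \<in> down (w y). f u y}" for y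
  have "finite (col ` K)"
  proof (cases "K = {}")
    case False
    then obtain y0 where y0: "y0 \<in> K" by blast
    have "col y \<subseteq> traces (w y0) x" if "y \<in> K" for y
      using stable_traces_eq[OF w(1)[OF that] w(1)[OF y0]] unfolding col_def by blast
    then have "col ` K \<subseteq> Pow (traces (w y0) x)" by blast
    moreover have "finite (traces (w y0) x)"
      using w[OF y0] finite_traces unfolding stable_def by blast
    ultimately show ?thesis by (meson finite_Pow_iff finite_subset)
  qed simp
  moreover have "fine r `` {y} = fine r `` {z}"
    if yz: "y \<in> K" "z \<in> K" "col y = col z" for y z
  proof -
    obtain d where d: "stable r d y" "stable r d z" "down d \<subseteq> down (w y) \<inter> down (w z)"
      using stable_common[OF w(2)[OF yz(1)] w(1)[OF yz(1)] w(1)[OF yz(2)] w(2)[OF yz(2)]] by blast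
    \<comment> \<open>Equality of colours yields \<open>u'\<close> with \<open>f u' z\<close> and
      the same trace as \<open>u\<close> at \<open>x\<close>, hence also at \<open>z\<close>; the
      trace at \<open>z\<close> decides \<open>f u z\<close>.\<close>
    have *: "f u z" if "y \<in> K" "z \<in> K" "col y = col z" "u \<in> down (w y) \<inter> down (w z)" "f u y" for u y z
    proof -
      have "trace x u \<in> col z" using that unfolding col_def by blast
      then obtain u' where u': "u' \<in> down (w z)" "f u' z" "trace x u = trace x u'"
        unfolding col_def by blast
      then have "trace z u = trace z u'"
        using stable_trace_eq_iff[OF w[OF that(2)]] that by blast
      moreover have "z \<in> X" using w[OF that(2)] unfolding stable_def by simp
      ultimately show ?thesis using u' mem_trace_self by blast
    qed
    have "\<forall>u\<in>down d. f u y \<longleftrightarrow> f u z"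
      using *[OF yz] *[OF yz(2,1) yz(3)[symmetric]] d(3) by blast
    then have "(y, z) \<in> fine r" using d unfolding fine_def stable_def by blast
    then show ?thesis using equiv_class_eq[OF equiv_fine] by blast
  qed
  ultimately have "finite ((\<lambda>y. fine r `` {y}) ` K)"
    using finite_image_of_finer[of col K "\<lambda>y. fine r `` {y}"] by blast
  then have fin: "finite ((\<lambda>y. fine r `` {y}) ` insert x K)" by simp
  have sub: "coarse r `` {x} \<subseteq> insert x K" unfolding K_def by auto
  show ?thesis by (rule finite_subset[OF image_mono[OF sub] fin])
qed

lemma almost_convex_fine: "almost_convex_equiv X lt (fine r)"
  unfolding almost_convex_equiv_def
proof (intro conjI equiv_fine exI ballI)
  show "convex_equiv X lt (coarse r)" "fine r \<subseteq> coarse r"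
    by (fact convex_coarse, fact fine_subset_coarse)
  fix C assume "C \<in> X // coarse r"
  then obtain x where x: "x \<in> X" "C = coarse r `` {x}" by (auto elim: quotientE)
  have "{D \<in> X // fine r. D \<subseteq> C} \<subseteq> (\<lambda>y. fine r `` {y}) ` C"
  proof
    fix D assume D: "D \<in> {D \<in> X // fine r. D \<subseteq> C}"
    then obtain y where y: "y \<in> X" "D = fine r `` {y}" by (auto elim: quotientE)
    then have "y \<in> D" using equiv_class_self[OF equiv_fine] by blast
    then show "D \<in> (\<lambda>y. fine r `` {y}) ` C" using D y by blast
  qed
  then show "finite {D \<in> X // fine r. D \<subseteq> C}"
    using finite_fine_classes[OF x(1)] x(2) finite_subset by blast
qed

text \<open>The coarse classes are needed as well, to mark where a region of constant rank ends. The
  relation is convex itself, so each class is a single piece.\<close>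

lemma almost_convex_coarse: "almost_convex_equiv X lt (coarse r)"
  unfolding almost_convex_equiv_def
proof (intro conjI equiv_coarse exI ballI)
  show "convex_equiv X lt (coarse r)" by (rule convex_coarse)
  fix C assume C: "C \<in> X // coarse r"
  have "{D \<in> X // coarse r. D \<subseteq> C} \<subseteq> {C}"
  proof
    fix D assume D: "D \<in> {D \<in> X // coarse r. D \<subseteq> C}"
    then have "D \<noteq> {}" using in_quotient_imp_non_empty[OF equiv_coarse] by blast
    then show "D \<in> {C}" using quotient_disj[OF equiv_coarse, of D _ C] C D by blast
  qed
  then show "finite {D \<in> X // coarse r. D \<subseteq> C}" by (rule finite_subset) simp
qed simp

section \<open>One-sided fibres as Boolean combinations\<close>

context
  fixes G :: "'a set set" and a :: 'a
  assumes a: "a \<in> X"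
    and X_G: "X \<in> G"
    and up_G: "\<And>b. b \<in> X \<Longrightarrow> {x \<in> X. lt b x} \<in> G"
    and classes_G: "\<And>r. X // coarse r \<subseteq> G" "\<And>r. X // fine r \<subseteq> G"
begin

text \<open>If some \<open>z\<close> has rank exactly \<open>r\<close>, the points above \<open>a\<close> of rank at least \<open>r\<close> form an initial
  segment of the ray above \<open>a\<close>, ending where the class of \<open>z\<close> ends.\<close>

lemma rank_ge_boolean_combination:
  "{x \<in> X. lt a x \<and> r \<le> card (traces a x)} \<in> boolean_combinations X G" (is "?Q r \<in> ?B")
proof -
  obtain N where bound: "\<And>x. x \<in> X \<Longrightarrow> lt a x \<Longrightarrow> card (traces a x) \<le> N"
    using bounded_card_traces[OF a] by blast
  have up: "{x \<in> X. lt b x} \<in> ?B" if "b \<in> X" for b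
    using that up_G boolean_combinations.gen by metis
  have XB: "X \<in> ?B" using X_G boolean_combinations.gen by metis
  \<comment> \<open>Downward induction on the rank: above the bound \<open>N\<close> the set is
    empty, and \<open>k\<close> counts the steps down.\<close>
  have "?Q (Suc N - k) \<in> ?B" for k
  proof (induction k)
    case 0
    have "?Q (Suc N) = {}" using bound by fastforce
    then have "?Q (Suc N) \<in> ?B" by (simp only: boolean_combinations_empty[OF XB])
    then show ?case by (simp only: diff_zero)
  next
    case (Suc k)
    show ?case
    proof (cases "k \<le> N")
      case False
      \<comment> \<open>Subtraction truncates here: both \<open>Suc N - k\<close> and
        \<open>Suc N - Suc k\<close> are 0.\<close>
      then show ?thesis using Suc by (simp add: Suc_diff_le)
    next
      case True
      define q where "q = Suc N - Suc k"
      have q: "Suc N - k = Suc q" using True unfolding q_def by simp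
      show ?thesis
      proof (cases "\<exists>z\<in>X. lt a z \<and> card (traces a z) = q")
        case False
        then have "?Q q = ?Q (Suc q)" by (auto simp: Suc_le_eq le_less)
        then show ?thesis using Suc q unfolding q_def[symmetric] by simp
      next
        case True
        then obtain z where z: "z \<in> X" "lt a z" "card (traces a z) = q" by blast
        then have sz: "stable q a z" using a unfolding stable_def by simp
        define K where "K = coarse q `` {z}"
        have KB: "K \<in> ?B"
          using classes_G(1)[of q] quotientI[OF z(1), of "coarse q"] boolean_combinations.gen
          unfolding K_def by blast
        have KX: "K \<subseteq> X" unfolding K_def coarse_def by auto
        \<comment> \<open>Up to \<open>z\<close> all ranks are at least \<open>q\<close>. Beyond
          \<open>z\<close> they are at most \<open>q\<close>, so there the condition means rank
          exactly \<open>q\<close>, that is, membership in the class of \<open>z\<close>.\<close>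
        have Q_eq: "?Q q = ({x \<in> X. lt a x} - {x \<in> X. lt z x}) \<union> (K \<inter> {x \<in> X. lt z x})"
        proof (intro set_eqI)
          fix y
          show "y \<in> ?Q q \<longleftrightarrow> y \<in> ({x \<in> X. lt a x} - {x \<in> X. lt z x}) \<union> (K \<inter> {x \<in> X. lt z x})"
          proof (cases "y \<in> X \<and> lt z y")
            case True
            then have ay: "lt a y" using z a lt_trans by blast
            have le: "card (traces a y) \<le> q" using card_traces_later[of a z y] z a True by blast
            have "q \<le> card (traces a y) \<longleftrightarrow> y \<in> K"
            proof
              assume "q \<le> card (traces a y)"
              then have "stable q a y" using le ay a True unfolding stable_def by simp
              then show "y \<in> K" using sz True z unfolding K_def coarse_def by blast
            next
              assume "y \<in> K"
              moreover have "y \<noteq> z" using True lt_irrefl z by blast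
              ultimately obtain c where c: "stable q c z" "stable q c y"
                unfolding K_def coarse_def by auto
              \<comment> \<open>The witness \<open>c\<close> need not be \<open>a\<close>, but both
                have rank \<open>q\<close> at \<open>z\<close>, hence the same traces there and at
                the later point \<open>y\<close>.\<close>
              have "traces a y = traces c y"
                using stable_traces_eq[OF sz c(1)] traces_later[of z y] z True by simp
              then show "q \<le> card (traces a y)" using c unfolding stable_def by simp
            qed
            then show ?thesis using True ay by auto
          next
            case False
            have "q \<le> card (traces a y)" if "y \<in> X" "lt a y"
              using card_traces_later[of a y z] that z a False lt_cases by blast
            then show ?thesis using False KX by auto
          qed
        qed
        have "{x \<in> X. lt a x} - {x \<in> X. lt z x} \<in> ?B"
          using boolean_combinations_diff[OF up[OF a] up[OF z(1)]] by blast
        moreover have "K \<inter> {x \<in> X. lt z x} \<in> ?B"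
          using boolean_combinations.inter[OF KB up[OF z(1)]] .
        ultimately have "?Q q \<in> ?B" by (subst Q_eq) (rule boolean_combinations.union)
        then show ?thesis by (simp only: q_def)
      qed
    qed
  qed
  note 1 = this
  show ?thesis
  proof (cases "r \<le> Suc N")
    case True
    then show ?thesis using 1[of "Suc N - r"] by simp
  next
    case False
    then have "?Q r = {}" using bound by fastforce
    then show ?thesis by (simp only: boolean_combinations_empty[OF XB])
  qed
qed

text \<open>A piece \<open>P r\<close> lies in one coarse class, with \<open>a\<close> as witness,
  and so meets finitely many fine classes. Within \<open>P r\<close> each of these lies entirely
  inside or entirely outside the fibre.\<close>

lemma fibre_boolean_combination:
  "{x \<in> X. lt a x \<and> f a x} \<in> boolean_combinations X G" (is "?D \<in> ?B")
proof -
  obtain N where bound: "\<And>x. x \<in> X \<Longrightarrow> lt a x \<Longrightarrow> card (traces a x) \<le> N"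
    using bounded_card_traces[OF a] by blast
  define P where "P r = {x \<in> X. lt a x \<and> card (traces a x) = r}" for r
  have XB: "X \<in> ?B" using X_G boolean_combinations.gen by metis
  have PB: "P r \<in> ?B" for r
  proof -
    have "P r = {x \<in> X. lt a x \<and> r \<le> card (traces a x)}
        - {x \<in> X. lt a x \<and> Suc r \<le> card (traces a x)}" unfolding P_def by auto
    then show ?thesis
      using boolean_combinations_diff[OF rank_ge_boolean_combination rank_ge_boolean_combination]
      by (simp add: Collect_mono_iff)
  qed
  have "?D \<inter> P r \<in> ?B" for r
  proof (cases "?D \<inter> P r = {}")
    case True
    then show ?thesis using boolean_combinations_empty[OF XB] by simp
  next
    case False
    then obtain z where z: "z \<in> P r" by blast
    have st: "stable r a x" if "x \<in> P r" for x using that a unfolding P_def stable_def by simp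
    let ?F = "(\<lambda>y. fine r `` {y}) ` (?D \<inter> P r)"
    have "P r \<subseteq> coarse r `` {z}" using st[OF z] st z unfolding coarse_def stable_def by blast
    then have "?F \<subseteq> (\<lambda>y. fine r `` {y}) ` (coarse r `` {z})" by blast
    then have "finite ?F" using finite_fine_classes[of z r] z finite_subset unfolding P_def by blast
    moreover have "?F \<subseteq> ?B"
      using classes_G(2)[of r] boolean_combinations.gen
      by (auto intro!: boolean_combinations.gen quotientI)
    ultimately have FB: "\<Union>?F \<in> ?B" using boolean_combinations_Union XB by blast
    have D_eq: "?D \<inter> P r = P r \<inter> \<Union>?F"
    proof
      show "?D \<inter> P r \<subseteq> P r \<inter> \<Union>?F" using equiv_class_self[OF equiv_fine] by blast
      show "P r \<inter> \<Union>?F \<subseteq> ?D \<inter> P r"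
      proof
        fix y assume "y \<in> P r \<inter> \<Union>?F"
        then obtain x where x: "x \<in> ?D" "x \<in> P r" "(x, y) \<in> fine r" and y: "y \<in> P r" by blast
        have "f a y"
        proof (cases "x = y")
          case True
          then show ?thesis using x by blast
        next
          case False
          then obtain c where c: "stable r c x" "stable r c y" "\<forall>u\<in>down c. f u x \<longleftrightarrow> f u y"
            using x unfolding fine_def by blast
          \<comment> \<open>The witness \<open>c\<close> may lie below \<open>a\<close>, and then
            agreement up to \<open>c\<close> says nothing about \<open>a\<close> directly. As
            \<open>d\<close> and \<open>a\<close> have the same rank at \<open>x\<close>, some
            \<open>u\<close> up to \<open>d\<close> has the same trace as \<open>a\<close> at
            \<open>x\<close>, hence at \<open>y\<close>, and stands in for \<open>a\<close>.\<close>
          obtain d where d: "stable r d x" "stable r d y" "down d \<subseteq> down c \<inter> down a"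
            using stable_common[OF c(2,1) st[OF x(2)] st[OF y]]
              stable_common[OF c(1) c(1) st[OF x(2)] st[OF y]] by metis
          have ad: "a \<in> down a" using a unfolding down_def by simp
          have "trace x a \<in> traces a x" using ad by blast
          then obtain u where u: "u \<in> down d" "trace x a = trace x u"
            using stable_traces_eq[OF st[OF x(2)] d(1)] by auto
          have ua: "u \<in> down a" using u d by blast
          have "trace y a = trace y u"
            using stable_trace_eq_iff[OF st[OF x(2)] st[OF y] ad ua] u by blast
          moreover have "x \<in> X" "y \<in> X" using x y unfolding P_def by auto
          moreover have "f u x \<longleftrightarrow> f u y" using u d c by blast
          ultimately show ?thesis using u x mem_trace_self by blast
        qed
        then show "y \<in> ?D \<inter> P r" using y unfolding P_def by blast
      qed
    qed
    show ?thesis by (subst D_eq) (rule boolean_combinations.inter[OF PB FB])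
  qed
  then have "\<Union>((\<lambda>r. ?D \<inter> P r) ` {..N}) \<in> ?B"
    using boolean_combinations_Union[of "(\<lambda>r. ?D \<inter> P r) ` {..N}" X G] XB by blast
  moreover have "\<Union>((\<lambda>r. ?D \<inter> P r) ` {..N}) = ?D" using bound unfolding P_def by auto
  ultimately show ?thesis by simp
qed

end

end

section \<open>Definability\<close>

fun ren_tm :: "(nat \<Rightarrow> nat) \<Rightarrow> 'f tm \<Rightarrow> 'f tm" where
  "ren_tm \<sigma> (Var i) = Var (\<sigma> i)"
| "ren_tm \<sigma> (App f ts) = App f (map (ren_tm \<sigma>) ts)"

lemma val_ren_tm: "val M e (ren_tm \<sigma> t) = val M (e \<circ> \<sigma>) t"
  by (induction t) (simp_all cong: map_cong)

lemma fv_ren_tm: "fv_tm (ren_tm \<sigma> t) = \<sigma> ` fv_tm t"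
  by (induction t) auto

lemma wf_ren_tm: "wf_tm L t \<Longrightarrow> wf_tm L (ren_tm \<sigma> t)"
  by (induction t) auto

lemma finite_fv_tm: "finite (fv_tm t)"
  by (induction t) auto

lemma finite_fv: "finite (fv \<phi>)"
  by (induction \<phi>) (auto simp: finite_fv_tm)

lemma val_cong: "(\<And>i. i \<in> fv_tm t \<Longrightarrow> e i = e' i) \<Longrightarrow> val M e t = val M e' t"
proof (induction t)
  case (App f ts)
  have "map (val M e) ts = map (val M e') ts"
    by (intro map_cong refl App.IH) (auto intro!: App.prems)
  then show ?case by (simp only: val.simps)
qed simp

lemma sat_cong: "(\<And>i. i \<in> fv \<phi> \<Longrightarrow> e i = e' i) \<Longrightarrow> sat M e \<phi> \<longleftrightarrow> sat M e' \<phi>"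
proof (induction \<phi> arbitrary: e e')
  case (Eq s t)
  then have "val M e s = val M e' s" "val M e t = val M e' t" by (auto intro!: val_cong)
  then show ?case by simp
next
  case (Rel r ts)
  then have "map (val M e) ts = map (val M e') ts" by (intro map_cong refl val_cong) auto
  then show ?case by (simp only: sat.simps)
next
  case (Neg \<phi>)
  have "sat M e \<phi> \<longleftrightarrow> sat M e' \<phi>" by (rule Neg.IH) (simp add: Neg.prems)
  then show ?case by simp
next
  case (And \<phi> \<psi>)
  have "sat M e \<phi> \<longleftrightarrow> sat M e' \<phi>" "sat M e \<psi> \<longleftrightarrow> sat M e' \<psi>"
    by (rule And.IH, simp add: And.prems)+
  then show ?case by simp
next
  case (Ex i \<phi>)
  have "sat M (e(i := u)) \<phi> \<longleftrightarrow> sat M (e'(i := u)) \<phi>" for u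
    by (rule Ex.IH) (simp add: Ex.prems)
  then show ?case by simp
qed

text \<open>The map \<open>\<sigma>\<close> need not be injective; this later serves to merge
  parameters and to remove unwanted free variables.\<close>

lemma rename_formula:
  assumes "wf_fm L \<phi>"
  obtains \<psi> where "wf_fm L \<psi>" "fv \<psi> \<subseteq> \<sigma> ` fv \<phi>" "\<And>e. sat M e \<psi> \<longleftrightarrow> sat M (e \<circ> \<sigma>) \<phi>"
proof -
  have "\<exists>\<psi>. wf_fm L \<psi> \<and> fv \<psi> \<subseteq> \<sigma> ` fv \<phi> \<and> (\<forall>e. sat M e \<psi> \<longleftrightarrow> sat M (e \<circ> \<sigma>) \<phi>)"
    using assms
  proof (induction \<phi> arbitrary: \<sigma>)
    case (Eq s t)
    then show ?case
      by (intro exI[of _ "Eq (ren_tm \<sigma> s) (ren_tm \<sigma> t)"])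
        (auto simp: fv_ren_tm wf_ren_tm val_ren_tm o_def)
  next
    case (Rel r ts)
    then show ?case
      by (intro exI[of _ "Rel r (map (ren_tm \<sigma>) ts)"])
        (auto simp: fv_ren_tm wf_ren_tm val_ren_tm o_def)
  next
    case (Neg \<phi>)
    then obtain \<psi> where "wf_fm L \<psi> \<and> fv \<psi> \<subseteq> \<sigma> ` fv \<phi> \<and> (\<forall>e. sat M e \<psi> \<longleftrightarrow> sat M (e \<circ> \<sigma>) \<phi>)"
      by fastforce
    then show ?case by (intro exI[of _ "Neg \<psi>"]) (auto simp: o_def)
  next
    case (And \<phi>1 \<phi>2)
    obtain \<psi>1 where 1: "wf_fm L \<psi>1 \<and> fv \<psi>1 \<subseteq> \<sigma> ` fv \<phi>1 \<and> (\<forall>e. sat M e \<psi>1 \<longleftrightarrow> sat M (e \<circ> \<sigma>) \<phi>1)"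
      using And.IH(1)[of \<sigma>] And.prems unfolding wf_fm.simps by blast
    obtain \<psi>2 where 2: "wf_fm L \<psi>2 \<and> fv \<psi>2 \<subseteq> \<sigma> ` fv \<phi>2 \<and> (\<forall>e. sat M e \<psi>2 \<longleftrightarrow> sat M (e \<circ> \<sigma>) \<phi>2)"
      using And.IH(2)[of \<sigma>] And.prems unfolding wf_fm.simps by blast
    show ?case using 1 2 by (intro exI[of _ "And \<psi>1 \<psi>2"]) (auto simp: o_def)
  next
    case (Ex i \<phi>)
    \<comment> \<open>The bound variable gets a fresh name \<open>j\<close>, so that no free
      variable is captured.\<close>
    have "finite (\<sigma> ` (fv \<phi> - {i}))" using finite_fv[of \<phi>] by simp
    then obtain j where j: "j \<notin> \<sigma> ` (fv \<phi> - {i})"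
      using ex_new_if_finite[OF infinite_UNIV_nat] by blast
    obtain \<psi> where \<psi>: "wf_fm L \<psi>" "fv \<psi> \<subseteq> \<sigma>(i := j) ` fv \<phi>"
      "\<And>e. sat M e \<psi> \<longleftrightarrow> sat M (e \<circ> \<sigma>(i := j)) \<phi>"
      using Ex.IH[of "\<sigma>(i := j)"] Ex.prems unfolding wf_fm.simps by blast
    have "sat M (e(j := u)) \<psi> \<longleftrightarrow> sat M ((e \<circ> \<sigma>)(i := u)) \<phi>" for e u
      unfolding \<psi>(3) using j by (intro sat_cong) auto
    moreover have "fv \<psi> - {j} \<subseteq> \<sigma> ` (fv \<phi> - {i})" using \<psi>(2) by auto
    ultimately show ?case using \<psi>(1) by (intro exI[of _ "Ex j \<psi>"]) (auto simp: o_def)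
  qed
  then show thesis using that by blast
qed

text \<open>Turns a lower bound on a cardinality into the existence of finitely many elements with
  distinct values, which is first-order once equality of values is definable.\<close>

lemma le_card_image_iff:
  assumes "finite V" "finite (h ` A)"
  shows "card V \<le> card (h ` A) \<longleftrightarrow> (\<exists>g. (\<forall>i\<in>V. g i \<in> A) \<and> inj_on (\<lambda>i. h (g i)) V)"
proof
  assume "card V \<le> card (h ` A)"
  then obtain W where W: "W \<subseteq> h ` A" "card W = card V" "finite W"
    by (rule obtain_subset_with_card_n)
  then obtain b where b: "bij_betw b V W"
    using finite_same_card_bij[OF assms(1)] by metis
  define g where "g i = inv_into A h (b i)" for i
  have "b i \<in> h ` A" if "i \<in> V" for i using that b W unfolding bij_betw_def by blast
  then have g: "g i \<in> A" "h (g i) = b i" if "i \<in> V" for i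
    using that unfolding g_def by (auto intro: inv_into_into f_inv_into_f)
  then have "inj_on (\<lambda>i. h (g i)) V"
    using b unfolding bij_betw_def by (metis (mono_tags, lifting) inj_on_cong)
  then show "\<exists>g. (\<forall>i\<in>V. g i \<in> A) \<and> inj_on (\<lambda>i. h (g i)) V" using g by blast
next
  assume "\<exists>g. (\<forall>i\<in>V. g i \<in> A) \<and> inj_on (\<lambda>i. h (g i)) V"
  then obtain g where g: "\<forall>i\<in>V. g i \<in> A" "inj_on (\<lambda>i. h (g i)) V" by blast
  then have "(\<lambda>i. h (g i)) ` V \<subseteq> h ` A" by blast
  then show "card V \<le> card (h ` A)" using card_inj_on_le[OF g(2) _ assms(2)] by blast
qed

section \<open>Definable predicates and definable sets\<close>

locale definability =
  fixes L :: "('f, 'r) language" and M :: "('f, 'r, 'u) struct"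
begin

text \<open>Working with predicates on assignments lets closure properties replace explicit
  formulas.\<close>

definition dpred :: "((nat \<Rightarrow> 'u) \<Rightarrow> bool) \<Rightarrow> bool" where
  "dpred P \<longleftrightarrow> (\<exists>\<phi>\<in>formulas L. \<forall>e. range e \<subseteq> dom M \<longrightarrow> (sat M e \<phi> \<longleftrightarrow> P e))"

abbreviation drel :: "('u \<Rightarrow> 'u \<Rightarrow> bool) \<Rightarrow> bool" where
  "drel Q \<equiv> dpred (\<lambda>e. Q (e 0) (e 1))"

text \<open>Every value of \<open>e\<close> lies in \<open>A\<close>, so nothing is definable over
  the empty set; parameter sets are therefore kept nonempty.\<close>

definition definable_over :: "'u set \<Rightarrow> 'u set \<Rightarrow> bool" where
  "definable_over A S \<longleftrightarrow>
     (\<exists>Q e. dpred Q \<and> range e \<subseteq> A \<and> S = {u \<in> dom M. Q (e(0 := u))})"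

lemma dpred_sat: "\<phi> \<in> formulas L \<Longrightarrow> dpred (\<lambda>e. sat M e \<phi>)"
  unfolding dpred_def by blast

lemma dpred_cong:
  assumes "dpred P" "\<And>e. range e \<subseteq> dom M \<Longrightarrow> P e \<longleftrightarrow> Q e"
  shows "dpred Q"
  using assms unfolding dpred_def by auto

lemma dpred_not: "dpred P \<Longrightarrow> dpred (\<lambda>e. \<not> P e)"
proof -
  assume "dpred P"
  then obtain \<phi> where "\<phi> \<in> formulas L" "\<forall>e. range e \<subseteq> dom M \<longrightarrow> (sat M e \<phi> \<longleftrightarrow> P e)"
    unfolding dpred_def by blast
  then show ?thesis unfolding dpred_def by (intro bexI[of _ "Neg \<phi>"]) (auto simp: formulas_def)
qed

lemma dpred_conj: "dpred P \<Longrightarrow> dpred Q \<Longrightarrow> dpred (\<lambda>e. P e \<and> Q e)"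
proof -
  assume "dpred P" "dpred Q"
  then obtain \<phi> \<psi> where "\<phi> \<in> formulas L" "\<forall>e. range e \<subseteq> dom M \<longrightarrow> (sat M e \<phi> \<longleftrightarrow> P e)"
    "\<psi> \<in> formulas L" "\<forall>e. range e \<subseteq> dom M \<longrightarrow> (sat M e \<psi> \<longleftrightarrow> Q e)"
    unfolding dpred_def by blast
  then show ?thesis unfolding dpred_def by (intro bexI[of _ "And \<phi> \<psi>"]) (auto simp: formulas_def)
qed

lemma dpred_disj: "dpred P \<Longrightarrow> dpred Q \<Longrightarrow> dpred (\<lambda>e. P e \<or> Q e)"
  using dpred_not[OF dpred_conj[OF dpred_not dpred_not, of P Q]] by simp

lemma dpred_imp: "dpred P \<Longrightarrow> dpred Q \<Longrightarrow> dpred (\<lambda>e. P e \<longrightarrow> Q e)"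
  using dpred_disj[OF dpred_not, of P Q] by (simp only: imp_conv_disj)

lemma dpred_iff: "dpred P \<Longrightarrow> dpred Q \<Longrightarrow> dpred (\<lambda>e. P e \<longleftrightarrow> Q e)"
  using dpred_conj[OF dpred_imp dpred_imp, of P Q Q P] by (simp only: iff_conv_conj_imp)

lemma dpred_ex: "dpred P \<Longrightarrow> dpred (\<lambda>e. \<exists>u\<in>dom M. P (e(i := u)))"
proof -
  assume "dpred P"
  then obtain \<phi> where \<phi>: "\<phi> \<in> formulas L" "\<And>e. range e \<subseteq> dom M \<Longrightarrow> sat M e \<phi> \<longleftrightarrow> P e"
    unfolding dpred_def by blast
  have "range (e(i := u)) \<subseteq> dom M" if "range e \<subseteq> dom M" "u \<in> dom M" for e u
    using that by (auto simp: fun_upd_def)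
  then have "sat M e (Ex i \<phi>) \<longleftrightarrow> (\<exists>u\<in>dom M. P (e(i := u)))" if "range e \<subseteq> dom M" for e
    using that by (auto simp: \<phi>(2))
  moreover have "Ex i \<phi> \<in> formulas L" using \<phi>(1) by (simp add: formulas_def)
  ultimately show ?thesis unfolding dpred_def by blast
qed

lemma dpred_all: "dpred P \<Longrightarrow> dpred (\<lambda>e. \<forall>u\<in>dom M. P (e(i := u)))"
  using dpred_not[OF dpred_ex[OF dpred_not]] by simp

lemma dpred_rename: "dpred P \<Longrightarrow> dpred (\<lambda>e. P (\<lambda>i. e (\<sigma> i)))"
proof -
  assume "dpred P"
  then obtain \<phi> where \<phi>: "\<phi> \<in> formulas L" "\<And>e. range e \<subseteq> dom M \<Longrightarrow> sat M e \<phi> \<longleftrightarrow> P e"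
    unfolding dpred_def by blast
  obtain \<psi> where \<psi>: "wf_fm L \<psi>" "\<And>e. sat M e \<psi> \<longleftrightarrow> sat M (e \<circ> \<sigma>) \<phi>"
    by (rule rename_formula[of L \<phi> \<sigma> M]) (use \<phi>(1) in \<open>auto simp: formulas_def\<close>)
  have "sat M e \<psi> \<longleftrightarrow> P (\<lambda>i. e (\<sigma> i))" if "range e \<subseteq> dom M" for e
    using \<psi>(2)[of e] \<phi>(2)[of "e \<circ> \<sigma>"] that by (auto simp: o_def image_subset_iff)
  then show ?thesis using \<psi>(1) unfolding dpred_def formulas_def by blast
qed

lemma dpred_eq: "dpred (\<lambda>e. e i = e j)"
  unfolding dpred_def by (rule bexI[of _ "Eq (Var i) (Var j)"]) (auto simp: formulas_def)

lemma drel_rename: "drel Q \<Longrightarrow> dpred (\<lambda>e. Q (e i) (e j))"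
  using dpred_rename[of "\<lambda>e. Q (e 0) (e 1)" "\<lambda>k. if k = 0 then i else j"] by simp

lemma dpred_rename3: "dpred (\<lambda>e. Q (e 0) (e 1) (e 2)) \<Longrightarrow> dpred (\<lambda>e. Q (e i) (e j) (e k))"
  using dpred_rename[of "\<lambda>e. Q (e 0) (e 1) (e 2)"
      "\<lambda>l. if l = 0 then i else if l = 1 then j else k"] by simp

lemma dpred_True: "dpred (\<lambda>e. True)"
  using dpred_eq[of 0 0] by simp

lemma dpred_finite_all:
  assumes "finite V" "\<And>i. i \<in> V \<Longrightarrow> dpred (P i)"
  shows "dpred (\<lambda>e. \<forall>i\<in>V. P i e)"
  using assms by (induction V) (auto intro: dpred_True dpred_conj)

text \<open>A block of single quantifiers, one for each variable of \<open>V\<close>; it serves to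
  quantify over \<open>r\<close> parameters at once.\<close>

lemma dpred_finite_ex_block:
  assumes "finite V" "dpred P"
  shows "dpred (\<lambda>e. \<exists>g. g ` V \<subseteq> dom M \<and> P (override_on e g V))"
  using assms(1)
proof (induction V)
  case empty
  then show ?case using assms(2) by simp
next
  case (insert v V)
  have eq: "(\<exists>u\<in>dom M. \<exists>g. g ` V \<subseteq> dom M \<and> P (override_on (e(v := u)) g V)) \<longleftrightarrow>
      (\<exists>g. g ` insert v V \<subseteq> dom M \<and> P (override_on e g (insert v V)))" (is "?l \<longleftrightarrow> ?r") for e
  proof
    assume ?l
    then obtain u g where *: "u \<in> dom M" "g ` V \<subseteq> dom M" "P (override_on (e(v := u)) g V)" by blast
    have "override_on (e(v := u)) g V = override_on e (g(v := u)) (insert v V)"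
      using insert(2) by (auto simp: override_on_def)
    moreover have "(g(v := u)) ` insert v V \<subseteq> dom M" using * by auto
    ultimately show ?r using * by metis
  next
    assume ?r
    then obtain g where *: "g ` insert v V \<subseteq> dom M" "P (override_on e g (insert v V))" by blast
    have "override_on (e(v := g v)) g V = override_on e g (insert v V)"
      by (auto simp: override_on_def)
    then show ?l using * by (intro bexI[of _ "g v"] exI[of _ g]) auto
  qed
  show ?case by (rule dpred_cong[OF dpred_ex[OF insert.IH, of v]]) (rule eq)
qed

text \<open>Variables outside \<open>V\<close> are renamed to one fixed element of \<open>V\<close>,
  a change that \<open>P\<close> does not notice.\<close>

lemma dpred_supported:
  assumes "dpred P" "\<And>e e'. (\<And>i. i \<in> V \<Longrightarrow> e i = e' i) \<Longrightarrow> P e \<longleftrightarrow> P e'" "V \<noteq> {}"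
  obtains \<phi> where "\<phi> \<in> formulas L" "fv \<phi> \<subseteq> V" "\<And>e. range e \<subseteq> dom M \<Longrightarrow> sat M e \<phi> \<longleftrightarrow> P e"
proof -
  obtain \<phi> where \<phi>: "\<phi> \<in> formulas L" "\<And>e. range e \<subseteq> dom M \<Longrightarrow> sat M e \<phi> \<longleftrightarrow> P e"
    using assms(1) unfolding dpred_def by blast
  obtain v where v: "v \<in> V" using assms(3) by blast
  let ?\<sigma> = "\<lambda>i. if i \<in> V then i else v"
  obtain \<psi> where \<psi>: "wf_fm L \<psi>" "fv \<psi> \<subseteq> ?\<sigma> ` fv \<phi>" "\<And>e. sat M e \<psi> \<longleftrightarrow> sat M (e \<circ> ?\<sigma>) \<phi>"
    by (rule rename_formula[of L \<phi> ?\<sigma> M]) (use \<phi>(1) in \<open>auto simp: formulas_def\<close>)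
  have "sat M e \<psi> \<longleftrightarrow> P e" if "range e \<subseteq> dom M" for e
  proof -
    have "range (e \<circ> ?\<sigma>) \<subseteq> dom M" using that by auto
    moreover have "P (e \<circ> ?\<sigma>) \<longleftrightarrow> P e" by (rule assms(2)) simp
    ultimately show ?thesis using \<psi>(3) \<phi>(2) by blast
  qed
  moreover have "fv \<psi> \<subseteq> V" using \<psi>(2) v by auto
  ultimately show thesis using that \<psi>(1) unfolding formulas_def by blast
qed

lemma definable_rel_if_drel:
  assumes "drel Q" "\<And>x y. Q x y \<Longrightarrow> x \<in> dom M \<and> y \<in> dom M"
  shows "definable_rel L M {(x, y). Q x y}"
proof -
  obtain \<phi> where \<phi>: "\<phi> \<in> formulas L" "fv \<phi> \<subseteq> {0, 1}"
    "\<And>e. range e \<subseteq> dom M \<Longrightarrow> sat M e \<phi> \<longleftrightarrow> Q (e 0) (e 1)"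
    by (rule dpred_supported[OF assms(1), of "{0, 1}"]) auto
  have "sat M (e(0 := u, 1 := v)) \<phi> \<longleftrightarrow> Q u v" if "u \<in> dom M" "v \<in> dom M" for e u v
  proof -
    \<comment> \<open>The assignment \<open>e\<close> is arbitrary and may leave the domain, so it
      is first replaced by one with values \<open>u\<close> and \<open>v\<close> only.\<close>
    have "sat M (e(0 := u, 1 := v)) \<phi> \<longleftrightarrow> sat M (\<lambda>i. if i = 0 then u else v) \<phi>"
      using \<phi>(2) by (intro sat_cong) auto
    also have "\<dots> \<longleftrightarrow> Q u v" using \<phi>(3)[of "\<lambda>i. if i = 0 then u else v"] that by auto
    finally show ?thesis .
  qed
  then have "\<forall>e. {(x, y). Q x y} =
      {(u, v). u \<in> dom M \<and> v \<in> dom M \<and> sat M (e(0 := u, 1 := v)) \<phi>}"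
    using assms(2) by blast
  then show ?thesis using \<phi>(1,2) unfolding definable_rel_def by blast
qed

lemma definable_over_compl:
  assumes "definable_over A S"
  shows "definable_over A (dom M - S)"
proof -
  obtain Q e where "dpred Q" "range e \<subseteq> A" "S = {u \<in> dom M. Q (e(0 := u))}"
    using assms unfolding definable_over_def by blast
  then show ?thesis unfolding definable_over_def
    by (intro exI[of _ "\<lambda>e. \<not> Q e"] exI[of _ e]) (auto intro: dpred_not)
qed

lemma definable_over_inter:
  assumes "definable_over A S" "definable_over A S'"
  shows "definable_over A (S \<inter> S')"
proof -
  obtain Q e where *: "dpred Q" "range e \<subseteq> A" "S = {u \<in> dom M. Q (e(0 := u))}"
    using assms(1) unfolding definable_over_def by blast
  obtain Q' e' where Q': "dpred Q'" "range e' \<subseteq> A" "S' = {u \<in> dom M. Q' (e'(0 := u))}"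
    using assms(2) unfolding definable_over_def by blast
  define d where "d k = (if even k then e (k div 2) else e' (k div 2))" for k
  have "dpred (\<lambda>e. Q (\<lambda>i. e (2 * i)) \<and> Q' (\<lambda>i. e (if i = 0 then 0 else 2 * i + 1)))"
    using dpred_conj[OF dpred_rename[OF *(1)] dpred_rename[OF Q'(1)]] .
  moreover have "range d \<subseteq> A" using *(2) Q'(2) unfolding d_def by auto
  moreover have "(\<lambda>i. (d(0 := u)) (2 * i)) = e(0 := u)"
    "(\<lambda>i. (d(0 := u)) (if i = 0 then 0 else 2 * i + 1)) = e'(0 := u)" for u
    unfolding d_def by auto
  ultimately show ?thesis unfolding definable_over_def *(3) Q'(3)
    by (intro exI[of _ "\<lambda>e. Q (\<lambda>i. e (2 * i)) \<and> Q' (\<lambda>i. e (if i = 0 then 0 else 2 * i + 1))"]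
        exI[of _ d]) auto
qed

lemma definable_over_drel:
  assumes "drel Q" "a \<in> A"
  shows "definable_over A {t \<in> dom M. Q a t}"
  unfolding definable_over_def using drel_rename[OF assms(1), of 1 0] assms(2)
  by (intro exI[of _ "\<lambda>e. Q (e 1) (e 0)"] exI[of _ "\<lambda>_. a"]) auto

text \<open>All parameters equal \<open>a\<close>, so their variables can be merged into
  one.\<close>

lemma definable_over_singleton:
  assumes "definable_over {a} S"
  obtains Q where "drel Q" "S = {t \<in> dom M. Q a t}"
proof -
  obtain Q e where *: "dpred Q" "range e \<subseteq> {a}" "S = {u \<in> dom M. Q (e(0 := u))}"
    using assms unfolding definable_over_def by blast
  have "e i = a" for i using *(2) by auto
  then have "e(0 := u) = (\<lambda>i. if i = 0 then u else a)" for u by auto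
  moreover have "drel (\<lambda>x t. Q (\<lambda>i. if i = 0 then t else x))"
    using dpred_rename[OF *(1), of "\<lambda>i. if i = 0 then 1 else 0"] by (simp add: if_distrib)
  ultimately show thesis using that[of "\<lambda>x t. Q (\<lambda>i. if i = 0 then t else x)"] *(3) by simp
qed

lemma dpred_bex_drel:
  assumes "dpred (\<lambda>e. Q (e 0) (e 1) (e 2))"
  shows "drel (\<lambda>x y. \<exists>u\<in>dom M. Q x y u)" "drel (\<lambda>x y. \<forall>u\<in>dom M. Q x y u)"
  using dpred_ex[OF assms, of 2] dpred_all[OF assms, of 2] by simp_all

text \<open>The relations \<open>coarse r\<close> and \<open>fine r\<close> of a definable family are definable because their
  definition quantifies over the rank only through the fixed number \<open>r\<close>.\<close>

lemma drel_stable: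
  assumes "finite_cuts (dom M) lt f" "drel lt" "drel f"
  shows "drel (finite_cuts.stable (dom M) lt f r)"
proof -
  interpret finite_cuts "dom M" lt f by (rule assms(1))
  note lt_f = drel_rename[OF assms(2)] drel_rename[OF assms(3)]
  have down: "drel (\<lambda>c u. u \<in> down c)"
    using dpred_disj[OF dpred_eq[of 1 0] lt_f(1)[of 1 0]]
    by (rule dpred_cong) (auto simp: down_def)
  have "dpred (\<lambda>e. (e 3 = e 0 \<or> lt (e 0) (e 3)) \<longrightarrow> (f (e 1) (e 3) \<longleftrightarrow> f (e 2) (e 3)))"
    by (intro dpred_imp dpred_disj dpred_iff dpred_eq lt_f)
  from dpred_all[OF this, of 3]
  have "dpred (\<lambda>e. \<forall>t\<in>dom M. (t = e 0 \<or> lt (e 0) t) \<longrightarrow> (f (e 1) t \<longleftrightarrow> f (e 2) t))" by simp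
  then have trace: "dpred (\<lambda>e. trace (e 0) (e 1) = trace (e 0) (e 2))"
    by (rule dpred_cong) (auto simp: trace_def)
  have ge: "drel (\<lambda>c x. c \<in> dom M \<and> x \<in> dom M \<and> lt c x \<and> r \<le> card (traces c x))" for r
  proof -
    \<comment> \<open>Variables 0 and 1 hold \<open>c\<close> and \<open>x\<close>; the
      \<open>r\<close> variables from 2 on hold parameters up to \<open>c\<close> with distinct
      traces.\<close>
    define V where "V = {2..<r + 2}"
    have V: "finite V" "0 \<notin> V" "1 \<notin> V" "card V = r" unfolding V_def by auto
    define P where "P e \<longleftrightarrow> (\<forall>i\<in>V. e i \<in> down (e 0)) \<and>
      (\<forall>i\<in>V. \<forall>j\<in>V. i = j \<or> \<not> (trace (e 1) (e i) = trace (e 1) (e j)))" for e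
    \<comment> \<open>A comparison of indices is a constant truth value, not an equation between
      elements.\<close>
    have const: "dpred (\<lambda>e. i = j)" for i j :: nat
      using dpred_True dpred_not[OF dpred_True] by (cases "i = j") simp_all
    have P: "dpred P" unfolding P_def
      by (intro dpred_conj dpred_finite_all V dpred_disj dpred_not const drel_rename[OF down]
          dpred_rename3[OF trace])
    have "drel (\<lambda>c x. lt c x \<and> (\<exists>g. g ` V \<subseteq> dom M \<and>
        (\<forall>i\<in>V. g i \<in> down c) \<and>
        (\<forall>i\<in>V. \<forall>j\<in>V. i = j \<or> \<not> (trace x (g i) = trace x (g j)))))"
      by (rule dpred_cong[OF dpred_conj[OF assms(2) dpred_finite_ex_block[OF V(1) P]]])
        (use V in \<open>simp add: P_def override_on_def\<close>)
    then show ?thesis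
    proof (rule dpred_cong)
      fix e :: "nat \<Rightarrow> 'u" assume e: "range e \<subseteq> dom M"
      define c x where "c = e 0" and "x = e 1"
      have X: "c \<in> dom M" "x \<in> dom M" using e unfolding c_def x_def by auto
      have "lt c x \<Longrightarrow> r \<le> card (traces c x) \<longleftrightarrow>
          (\<exists>g. (\<forall>i\<in>V. g i \<in> down c) \<and> inj_on (\<lambda>i. trace x (g i)) V)"
        using le_card_image_iff[OF V(1) finite_traces[OF X]] V(4) by simp
      then show "(lt (e 0) (e 1) \<and> (\<exists>g. g ` V \<subseteq> dom M \<and>
          (\<forall>i\<in>V. g i \<in> down (e 0)) \<and>
          (\<forall>i\<in>V. \<forall>j\<in>V. i = j \<or> \<not> (trace (e 1) (g i) = trace (e 1) (g j))))) \<longleftrightarrow>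
        (e 0 \<in> dom M \<and> e 1 \<in> dom M \<and> lt (e 0) (e 1) \<and> r \<le> card (traces (e 0) (e 1)))"
        using X unfolding c_def[symmetric] x_def[symmetric] inj_on_def down_def by blast
    qed
  qed
  show ?thesis
    using dpred_conj[OF ge[of r] dpred_not[OF ge[of "Suc r"]]]
    by (rule dpred_cong) (auto simp: stable_def)
qed

lemma definable_coarse_fine:
  assumes "finite_cuts (dom M) lt f" "drel lt" "drel f"
  shows "definable_rel L M (finite_cuts.coarse (dom M) lt f r)"
    and "definable_rel L M (finite_cuts.fine (dom M) lt f r)"
proof -
  interpret finite_cuts "dom M" lt f by (rule assms(1))
  note st = drel_rename[OF drel_stable[OF assms, of r]]
  have "dpred (\<lambda>e. stable r (e 2) (e 0) \<and> stable r (e 2) (e 1))"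
    by (intro dpred_conj st)
  from dpred_disj[OF dpred_eq[of 0 1] dpred_bex_drel(1)[OF this]]
  have "drel (\<lambda>x y. x \<in> dom M \<and> y \<in> dom M \<and> (x = y \<or> (\<exists>c. stable r c x \<and> stable r c y)))"
    by (rule dpred_cong) (auto simp: stable_def)
  then show "definable_rel L M (coarse r)"
    unfolding coarse_def by (rule definable_rel_if_drel) blast
  \<comment> \<open>Variables 0 and 1 hold \<open>x\<close> and \<open>y\<close>, variable 2 the
    witness and variable 3 the parameter \<open>u\<close>.\<close>
  have "dpred (\<lambda>e. (e 3 = e 2 \<or> lt (e 3) (e 2)) \<longrightarrow> (f (e 3) (e 0) \<longleftrightarrow> f (e 3) (e 1)))"
    by (intro dpred_imp dpred_disj dpred_iff dpred_eq drel_rename[OF assms(2)] drel_rename[OF assms(3)])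
  from dpred_all[OF this, of 3]
  have "dpred (\<lambda>e. \<forall>u\<in>dom M. (u = e 2 \<or> lt u (e 2)) \<longrightarrow> (f u (e 0) \<longleftrightarrow> f u (e 1)))" by simp
  then have "dpred (\<lambda>e. stable r (e 2) (e 0) \<and> stable r (e 2) (e 1) \<and>
      (\<forall>u\<in>dom M. (u = e 2 \<or> lt u (e 2)) \<longrightarrow> (f u (e 0) \<longleftrightarrow> f u (e 1))))"
    by (intro dpred_conj st)
  from dpred_disj[OF dpred_eq[of 0 1] dpred_bex_drel(1)[OF this]]
  have "drel (\<lambda>x y. x \<in> dom M \<and> y \<in> dom M \<and> (x = y \<or>
      (\<exists>c. stable r c x \<and> stable r c y \<and> (\<forall>u\<in>down c. f u x \<longleftrightarrow> f u y))))"
    by (rule dpred_cong) (auto simp: stable_def down_def)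
  then show "definable_rel L M (fine r)"
    unfolding fine_def by (rule definable_rel_if_drel) blast
qed

end

section \<open>Saturation and linear binarity\<close>

context definability
begin

lemma definable_fibre_boolean_combination:
  assumes "finite_cuts (dom M) lt f" "drel lt" "drel f" "a \<in> dom M"
    and "dom M \<in> G" "\<And>b. b \<in> dom M \<Longrightarrow> {x \<in> dom M. lt b x} \<in> G"
    and "\<And>R. definable_rel L M R \<Longrightarrow> almost_convex_equiv (dom M) lt R \<Longrightarrow> dom M // R \<subseteq> G"
  shows "{x \<in> dom M. lt a x \<and> f a x} \<in> boolean_combinations (dom M) G"
proof -
  interpret finite_cuts "dom M" lt f by (rule assms(1))
  show ?thesis
    using assms(4-6) assms(7)[OF definable_coarse_fine(1)[OF assms(1-3)] almost_convex_coarse]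
      assms(7)[OF definable_coarse_fine(2)[OF assms(1-3)] almost_convex_fine]
    by (rule fibre_boolean_combination)
qed

end

text \<open>Gathers what saturation and (LB) provide. \<open>compact\<close> is saturation over
  finite parameter sets in terms of definable sets; \<open>binary\<close> is (LB) for tuples of
  \<open>M\<close>, with 2-types read as families of definable binary relations.\<close>

locale saturated_binary_order = definability L M
  for L :: "('f, 'r) language" and M :: "('f, 'r, 'u) struct" +
  fixes lt :: "'u \<Rightarrow> 'u \<Rightarrow> bool"
  assumes irrefl: "irreflp_on (dom M) lt"
    and trans: "transp_on (dom M) lt"
    and total: "totalp_on (dom M) lt"
    and drel_lt: "drel lt"
    and compact: "\<lbrakk>finite A; A \<subseteq> dom M; \<And>S. S \<in> F \<Longrightarrow> definable_over A S;
        \<And>Q. Q \<subseteq> F \<Longrightarrow> finite Q \<Longrightarrow> dom M \<inter> \<Inter>Q \<noteq> {}\<rbrakk> \<Longrightarrow> dom M \<inter> \<Inter>F \<noteq> {}"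
    and binary: "\<lbrakk>2 \<le> n; range a \<subseteq> dom M; range b \<subseteq> dom M;
        \<And>i. i \<in> {1..<n} \<Longrightarrow> lt (a i) (a (Suc i));
        \<And>i Q. i \<in> {1..<n} \<Longrightarrow> drel Q \<Longrightarrow> Q (a i) (a (Suc i)) \<Longrightarrow> Q (b i) (b (Suc i));
        dpred P; \<And>e e'. (\<And>i. i \<in> {1..n} \<Longrightarrow> e i = e' i) \<Longrightarrow> P e \<longleftrightarrow> P e'; P a\<rbrakk> \<Longrightarrow> P b"
begin

text \<open>A tuple increasing for the reversed order is increasing for \<open>lt\<close> when read
  backwards, and swapping the arguments keeps a binary relation definable.\<close>

lemma reverse: "saturated_binary_order L M (\<lambda>x y. lt y x)"
proof
  show "irreflp_on (dom M) (\<lambda>x y. lt y x)" using irrefl by (auto simp: irreflp_on_def)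
  show "transp_on (dom M) (\<lambda>x y. lt y x)" using trans unfolding transp_on_def by blast
  show "totalp_on (dom M) (\<lambda>x y. lt y x)" using total unfolding totalp_on_def by blast
  show "drel (\<lambda>x y. lt y x)" using drel_rename[OF drel_lt] .
  show "dom M \<inter> \<Inter>F \<noteq> {}" if "finite A" "A \<subseteq> dom M" "\<And>S. S \<in> F \<Longrightarrow> definable_over A S"
    "\<And>Q. Q \<subseteq> F \<Longrightarrow> finite Q \<Longrightarrow> dom M \<inter> \<Inter>Q \<noteq> {}" for A F
    using that by (rule compact)
  fix n P and a b :: "nat \<Rightarrow> 'u"
  assume *: "2 \<le> n" "range a \<subseteq> dom M" "range b \<subseteq> dom M"
    "\<And>i. i \<in> {1..<n} \<Longrightarrow> lt (a (Suc i)) (a i)"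
    "\<And>i Q. i \<in> {1..<n} \<Longrightarrow> drel Q \<Longrightarrow> Q (a i) (a (Suc i)) \<Longrightarrow> Q (b i) (b (Suc i))"
    "dpred P" "\<And>e e'. (\<And>i. i \<in> {1..n} \<Longrightarrow> e i = e' i) \<Longrightarrow> P e \<longleftrightarrow> P e'" "P a"
  \<comment> \<open>The map from \<open>i\<close> to \<open>n + 1 - i\<close> permutes
    \<open>{1..n}\<close>. Beyond \<open>n + 1\<close> subtraction truncates and reversing twice is
    not the identity, so the support of \<open>P\<close> is used.\<close>
  let ?rev = "\<lambda>e i. e (Suc n - i) :: 'u"
  have rev_rev: "P (?rev (?rev e)) \<longleftrightarrow> P e" for e
    by (rule *(7)) auto
  have "P (?rev (?rev b))"
  proof (rule binary[of n "?rev a" "?rev b" "\<lambda>e. P (?rev e)"])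
    fix i assume i: "i \<in> {1..<n}"
    then have j: "n - i \<in> {1..<n}" "Suc (n - i) = Suc n - i" "Suc n - Suc i = n - i" by auto
    show "lt (?rev a i) (?rev a (Suc i))" using *(4)[OF j(1)] j by simp
    fix Q assume Q: "drel Q" "Q (?rev a i) (?rev a (Suc i))"
    then show "Q (?rev b i) (?rev b (Suc i))"
      using *(5)[OF j(1) drel_rename[OF Q(1), of 1 0]] j by simp
  next
    fix e e' :: "nat \<Rightarrow> 'u" assume "\<And>i. i \<in> {1..n} \<Longrightarrow> e i = e' i"
    then have "?rev e i = ?rev e' i" if "i \<in> {1..n}" for i
      using that by (auto intro!: \<open>\<And>i. i \<in> {1..n} \<Longrightarrow> e i = e' i\<close>)
    then show "P (?rev e) \<longleftrightarrow> P (?rev e')" by (rule *(7))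
  next
    show "range (?rev a) \<subseteq> dom M" "range (?rev b) \<subseteq> dom M" using *(2,3) by auto
    show "dpred (\<lambda>e. P (?rev e))" by (rule dpred_rename[OF *(6)])
    show "P (?rev (?rev a))" using rev_rev *(8) by blast
  qed (rule *(1))
  then show "P b" using rev_rev by blast
qed

section \<open>Consequences of compactness and binarity\<close>

lemma lt_irrefl: "x \<in> dom M \<Longrightarrow> \<not> lt x x"
  using irrefl by (simp add: irreflp_on_def)

lemma lt_trans: "lt x y \<Longrightarrow> lt y z \<Longrightarrow> x \<in> dom M \<Longrightarrow> y \<in> dom M \<Longrightarrow> z \<in> dom M \<Longrightarrow> lt x z"
  using trans unfolding transp_on_def by blast

lemma lt_cases: "x \<in> dom M \<Longrightarrow> y \<in> dom M \<Longrightarrow> x = y \<or> lt x y \<or> lt y x"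
  using total unfolding totalp_on_def by blast

text \<open>Compactness is used twice: around each point of \<open>D\<close> a finite intersection
  of members of \<open>B\<close> stays inside \<open>D\<close>, and finitely many such intersections
  cover \<open>D\<close>.\<close>

lemma separated_boolean_combination:
  assumes A: "finite A" "A \<subseteq> dom M" and D: "definable_over A D"
    and B: "\<And>S. S \<in> B \<Longrightarrow> definable_over A S" "dom M \<in> B"
    and sep: "\<And>x y. x \<in> D \<Longrightarrow> y \<in> dom M - D \<Longrightarrow> \<exists>S\<in>B. x \<in> S \<and> y \<notin> S"
  shows "D \<in> boolean_combinations (dom M) B"
proof -
  have DM: "D \<subseteq> dom M" using D unfolding definable_over_def by auto
  have MB: "dom M \<in> boolean_combinations (dom M) B" by (rule boolean_combinations.gen) (rule B(2))
  have def_Inter: "definable_over A (dom M \<inter> \<Inter>F)" if "finite F" "F \<subseteq> B" for F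
    using that
  proof (induction F)
    case empty
    then show ?case using B by simp
  next
    case (insert S F)
    have "dom M \<inter> \<Inter>(insert S F) = S \<inter> (dom M \<inter> \<Inter>F)" by auto
    then show ?case using insert B(1) definable_over_inter by simp
  qed
  have "\<exists>F. finite F \<and> F \<subseteq> B \<and> x \<in> \<Inter>F \<and> dom M \<inter> \<Inter>F \<subseteq> D" if x: "x \<in> D" for x
  proof -
    let ?F = "insert (dom M - D) {S \<in> B. x \<in> S}"
    have "dom M \<inter> \<Inter>?F = {}" using sep[OF x] by auto
    then obtain Q where Q: "Q \<subseteq> ?F" "finite Q" "dom M \<inter> \<Inter>Q = {}"
      using compact[OF A, of ?F] definable_over_compl[OF D] B(1) by blast
    then show ?thesis using DM
      by (intro exI[of _ "Q - {dom M - D}"]) auto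
  qed
  then obtain N where N: "\<And>x. x \<in> D \<Longrightarrow> finite (N x) \<and> N x \<subseteq> B \<and> x \<in> \<Inter>(N x) \<and> dom M \<inter> \<Inter>(N x) \<subseteq> D"
    by metis
  define C where "C x = dom M \<inter> \<Inter>(N x)" for x
  have C: "x \<in> C x" "C x \<subseteq> D" "definable_over A (C x)" "C x \<in> boolean_combinations (dom M) B"
    if "x \<in> D" for x
  proof -
    show "x \<in> C x" "C x \<subseteq> D" using N[OF that] that DM unfolding C_def by auto
    show "definable_over A (C x)" using N[OF that] def_Inter unfolding C_def by blast
    have "N x \<subseteq> boolean_combinations (dom M) B"
      using N[OF that] boolean_combinations.gen[of _ B "dom M"] by blast
    then show "C x \<in> boolean_combinations (dom M) B"
      using N[OF that] MB boolean_combinations_Inter unfolding C_def by blast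
  qed
  let ?F = "insert D ((\<lambda>x. dom M - C x) ` D)"
  have "dom M \<inter> \<Inter>?F = {}" using C(1) by auto
  moreover have "\<And>S. S \<in> ?F \<Longrightarrow> definable_over A S"
    using D C(3) definable_over_compl by blast
  ultimately obtain Q where Q: "Q \<subseteq> ?F" "finite Q" "dom M \<inter> \<Inter>Q = {}"
    using compact[OF A, of ?F] by blast
  have "finite (Q - {D})" "Q - {D} \<subseteq> (\<lambda>x. dom M - C x) ` D" using Q by auto
  then obtain W where W: "W \<subseteq> D" "finite W" "Q - {D} = (\<lambda>x. dom M - C x) ` W"
    by (meson finite_subset_image)
  have "D = \<Union>(C ` W)"
  proof
    show "\<Union>(C ` W) \<subseteq> D" using C(2) W(1) by blast
    show "D \<subseteq> \<Union>(C ` W)"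
    proof
      fix x assume x: "x \<in> D"
      then have "x \<notin> \<Inter>(Q - {D})" using Q(3) DM by blast
      then show "x \<in> \<Union>(C ` W)" unfolding W(3) using x DM by blast
    qed
  qed
  moreover have "\<Union>(C ` W) \<in> boolean_combinations (dom M) B"
    using boolean_combinations_Union[of "C ` W"] W C(4) MB by blast
  ultimately show ?thesis by simp
qed

text \<open>(LB) for the triples \<open>(u, a, x)\<close> and \<open>(u, a, y)\<close>: the first
  pair is unchanged, and the second keeps every definable relation.\<close>

lemma binary_triple:
  assumes "u \<in> dom M" "a \<in> dom M" "x \<in> dom M" "y \<in> dom M" "lt u a" "lt a x"
    and "\<And>Q. drel Q \<Longrightarrow> Q a x \<Longrightarrow> Q a y" "drel f" "f u x"
  shows "f u y"
proof -
  define s where "s z = (\<lambda>i::nat. if i = 1 then u else if i = 2 then a else z)" for z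
  have "f (s y 1) (s y 3)"
  proof (rule binary[of 3 "s x" "s y" "\<lambda>e. f (e 1) (e 3)"])
    show "dpred (\<lambda>e. f (e 1) (e 3))" using drel_rename[OF assms(8)] .
    show "lt (s x i) (s x (Suc i))" if "i \<in> {1..<3}" for i
    proof -
      have "i = 1 \<or> i = 2" using that by auto
      then show ?thesis using assms unfolding s_def by auto
    qed
    show "Q (s y i) (s y (Suc i))" if "i \<in> {1..<3}" "drel Q" "Q (s x i) (s x (Suc i))" for i Q
    proof -
      have "i = 1 \<or> i = 2" using that by auto
      then show ?thesis using assms(7) that unfolding s_def by auto
    qed
  qed (use assms in \<open>auto simp: s_def\<close>)
  then show ?thesis unfolding s_def by simp
qed

text \<open>By binarity the trace above \<open>a\<close> of a parameter \<open>u\<close> up to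
  \<open>a\<close> is definable over \<open>a\<close> alone. So no such \<open>u\<close> has a trace
  outside \<open>B\<close>, and by compactness finitely many members of \<open>B\<close> contain all
  the traces.\<close>

lemma finite_cuts:
  assumes f: "drel f"
  shows "finite_cuts (dom M) lt f"
proof
  fix a assume a: "a \<in> dom M"
  define B where "B = {{t \<in> dom M. lt a t \<and> Q a t} | Q. drel Q}"
  define above where "above u = {t \<in> dom M. lt a t \<and> f u t}" for u
  define down where "down = {u \<in> dom M. u = a \<or> lt u a}"
  have B_def_over: "definable_over A S" if "S \<in> B" "a \<in> A" for S A
    using that definable_over_drel[OF dpred_conj[OF drel_lt]] unfolding B_def by blast
  have above_B: "above u \<in> B" if u: "u \<in> down" for u
  proof -
    have uM: "u \<in> dom M" using u unfolding down_def by simp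
    have dom_over: "definable_over A (dom M)" if "c \<in> A" for c A
      using definable_over_drel[OF dpred_True that] by simp
    have "above u = {t \<in> dom M. lt a t} \<inter> {t \<in> dom M. f u t}" unfolding above_def by auto
    then have over: "definable_over {u, a} (above u)"
      using definable_over_inter definable_over_drel[OF drel_lt] definable_over_drel[OF f] by simp
    \<comment> \<open>If \<open>B\<close> does not separate \<open>x\<close> from \<open>y\<close>,
      every definable relation of \<open>a\<close> to \<open>x\<close> passes to \<open>y\<close>;
      for \<open>u < a\<close>, \<open>binary_triple\<close> then gives
      \<open>f u y\<close>.\<close>
    have "above u \<in> boolean_combinations (dom M) (insert (dom M) B)"
    proof (rule separated_boolean_combination[OF _ _ over])
      show "finite {u, a}" "{u, a} \<subseteq> dom M" using a uM by auto
      show "definable_over {u, a} S" if "S \<in> insert (dom M) B" for S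
        using that B_def_over dom_over by blast
      fix x y assume x: "x \<in> above u" and y: "y \<in> dom M - above u"
      have "\<not> (\<forall>Q. drel Q \<longrightarrow> lt a x \<and> Q a x \<longrightarrow> lt a y \<and> Q a y)"
      proof
        assume *: "\<forall>Q. drel Q \<longrightarrow> lt a x \<and> Q a x \<longrightarrow> lt a y \<and> Q a y"
        have x': "x \<in> dom M" "lt a x" "f u x" using x unfolding above_def by auto
        have "lt a y" using *[rule_format, of "\<lambda>_ _. True"] dpred_True x' by blast
        moreover have "f u y"
        proof (cases "u = a")
          case True
          then show ?thesis using * f x' by blast
        next
          case False
          then show ?thesis using binary_triple[OF uM a x'(1), of y f] x' y u * f
            unfolding down_def by blast
        qed
        ultimately show False using y unfolding above_def by blast
      qed
      then obtain Q where "drel Q" "lt a x \<and> Q a x" "\<not> (lt a y \<and> Q a y)" by blast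
      moreover have "x \<in> dom M" using x unfolding above_def by simp
      ultimately show "\<exists>S\<in>insert (dom M) B. x \<in> S \<and> y \<notin> S"
        unfolding B_def by (intro bexI[of _ "{t \<in> dom M. lt a t \<and> Q a t}"]) auto
    qed simp
    \<comment> \<open>All members of \<open>B\<close> are definable over \<open>a\<close>, so
      \<open>u\<close> drops out of the parameters.\<close>
    then have "definable_over {a} (above u)"
    proof induction
      case (gen S)
      then show ?case using B_def_over dom_over by blast
    next
      case (union S S')
      have "S \<union> S' = dom M - ((dom M - S) \<inter> (dom M - S'))"
        using union.IH unfolding definable_over_def by blast
      then show ?case using union.IH definable_over_compl definable_over_inter by simp
    qed (auto intro: definable_over_compl definable_over_inter)
    then obtain Q where "drel Q" "above u = {t \<in> dom M. Q a t}"
      by (rule definable_over_singleton)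
    then show ?thesis unfolding B_def above_def by blast
  qed
  \<comment> \<open>Compactness is applied to these sets: a point of \<open>down\<close> lying in
    all of them would have a trace outside \<open>B\<close>.\<close>
  define diff where "diff S = {u \<in> dom M. above u \<noteq> S}" for S
  have diff: "definable_over {a} (diff S)" if S: "S \<in> B" for S
  proof -
    obtain Q where Q: "drel Q" "S = {t \<in> dom M. lt a t \<and> Q a t}" using S unfolding B_def by blast
    have "dpred (\<lambda>e. \<not> (lt (e 0) (e 2) \<longrightarrow> (f (e 1) (e 2) \<longleftrightarrow> Q (e 0) (e 2))))"
      by (intro dpred_not dpred_imp dpred_iff drel_rename[OF drel_lt] drel_rename[OF f]
          drel_rename[OF Q(1)])
    from definable_over_drel[OF dpred_bex_drel(1)[OF this], of a "{a}"]
    have "definable_over {a}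
        {u \<in> dom M. \<exists>t\<in>dom M. \<not> (lt a t \<longrightarrow> (f u t \<longleftrightarrow> Q a t))}" by simp
    moreover have "diff S = {u \<in> dom M. \<exists>t\<in>dom M. \<not> (lt a t \<longrightarrow> (f u t \<longleftrightarrow> Q a t))}"
      unfolding diff_def above_def Q(2) by auto
    ultimately show ?thesis by simp
  qed
  have "definable_over {a} down"
    using definable_over_drel[OF dpred_disj[OF dpred_eq[of 1 0] drel_rename[OF drel_lt, of 1 0]]]
    unfolding down_def by simp
  then have "\<And>S. S \<in> insert down (diff ` B) \<Longrightarrow> definable_over {a} S" using diff by auto
  moreover have "dom M \<inter> \<Inter>(insert down (diff ` B)) = {}"
  proof (rule equals0I)
    fix u assume u: "u \<in> dom M \<inter> \<Inter>(insert down (diff ` B))"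
    then have "above u \<in> B" by (intro above_B) simp
    then have "u \<in> diff (above u)" using u by blast
    then show False unfolding diff_def by simp
  qed
  ultimately obtain Q where Q: "Q \<subseteq> insert down (diff ` B)" "finite Q" "dom M \<inter> \<Inter>Q = {}"
    using compact[of "{a}" "insert down (diff ` B)"] a by blast
  have "finite (Q - {down})" "Q - {down} \<subseteq> diff ` B" using Q by auto
  then obtain W where W: "W \<subseteq> B" "finite W" "Q - {down} = diff ` W"
    by (meson finite_subset_image)
  have "above u \<in> W" if "u \<in> down" for u
  proof -
    have uM: "u \<in> dom M" using that unfolding down_def by simp
    then have "u \<notin> \<Inter>(Q - {down})" using that Q(3) by blast
    then show ?thesis unfolding W(3) diff_def using uM by blast
  qed
  then have "above ` down \<subseteq> W" by blast
  then show "finite ((\<lambda>u. {t \<in> dom M. lt a t \<and> f u t}) ` {u \<in> dom M. u = a \<or> lt u a})"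
    using W(2) finite_subset unfolding above_def down_def by blast
qed (fact irrefl trans total)+

lemma increasing_enumeration:
  assumes "finite A" "A \<subseteq> dom M"
  obtains a :: "nat \<Rightarrow> 'u" where "a ` {1..card A} = A" "\<And>i. i \<in> {1..<card A} \<Longrightarrow> lt (a i) (a (Suc i))"
proof -
  have "\<exists>a :: nat \<Rightarrow> 'u. a ` {1..card A} = A \<and> (\<forall>i\<in>{1..<card A}. lt (a i) (a (Suc i)))"
    using assms
  proof (induction "card A" arbitrary: A)
    case 0
    then show ?case by auto
  next
    case (Suc n)
    have "A \<noteq> {}" using Suc(2) by auto
    then obtain m where m: "m \<in> A" "\<forall>x\<in>A. x \<noteq> m \<longrightarrow> lt x m"
    proof -
      have "transp_on A lt" "asymp_on A lt"
        using Suc.prems(2) lt_trans lt_irrefl unfolding transp_on_def asymp_on_def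
        by (meson subsetD)+
      then obtain m where "m \<in> A" "\<forall>x\<in>A. x \<noteq> m \<longrightarrow> \<not> lt m x"
        using Finite_Set.bex_max_element[OF Suc.prems(1), of lt] \<open>A \<noteq> {}\<close> by blast
      then show thesis using that lt_cases Suc.prems(2) by (meson subsetD)
    qed
    have n: "card (A - {m}) = n" using Suc m by simp
    obtain a :: "nat \<Rightarrow> 'u" where a: "a ` {1..n} = A - {m}" "\<forall>i\<in>{1..<n}. lt (a i) (a (Suc i))"
      using Suc(1)[of "A - {m}"] n Suc.prems by auto
    let ?a = "a(Suc n := m)"
    have "?a ` {1..Suc n} = A"
    proof -
      have "?a ` {1..n} = A - {m}" unfolding a(1)[symmetric] by (intro image_cong) auto
      moreover have "{1..Suc n} = insert (Suc n) {1..n}" by auto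
      then have "?a ` {1..Suc n} = insert (?a (Suc n)) (?a ` {1..n})" by (simp only: image_insert)
      moreover have "?a (Suc n) = m" by simp
      ultimately show ?thesis using m(1) by (simp only: insert_Diff)
    qed
    moreover have "lt (?a i) (?a (Suc i))" if "i \<in> {1..<Suc n}" for i
    proof (cases "i = n")
      case True
      then have "a i \<in> A - {m}" using a(1) that by auto
      then show ?thesis using True m(2) by auto
    next
      case False
      then show ?thesis using a(2) that by auto
    qed
    ultimately show ?case using Suc(2) by metis
  qed
  then show thesis using that by blast
qed

text \<open>By linear binarity, only the types over the single parameters and the cut over the parameter
  set matter.\<close>

lemma one_parameter_boolean_combination:
  assumes A: "finite A" "A \<subseteq> dom M" "A \<noteq> {}" and D: "definable_over A D"
  defines "B \<equiv> {dom M} \<union> {{a} | a. a \<in> A} \<union> {{t \<in> dom M. lt a t \<and> Q a t} | a Q. a \<in> A \<and> drel Q}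
    \<union> {{t \<in> dom M. lt t a \<and> Q a t} | a Q. a \<in> A \<and> drel Q}"
  shows "D \<in> boolean_combinations (dom M) B"
proof (rule separated_boolean_combination[OF A(1,2) D])
  show "dom M \<in> B" unfolding B_def by blast
  fix S assume "S \<in> B"
  then consider "S = dom M" | a where "a \<in> A" "S = {a}"
    | a Q where "a \<in> A" "drel Q" "S = {t \<in> dom M. lt a t \<and> Q a t}"
    | a Q where "a \<in> A" "drel Q" "S = {t \<in> dom M. lt t a \<and> Q a t}"
    unfolding B_def by blast
  then show "definable_over A S"
  proof cases
    case 1
    then show ?thesis using definable_over_drel[OF dpred_True] A(3) by fastforce
  next
    case 2
    then have "S = {t \<in> dom M. a = t}" using A(2) by auto
    then show ?thesis using definable_over_drel[OF dpred_eq[of 0 1] 2(1)] by simp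
  next
    case 3
    then show ?thesis using definable_over_drel[OF dpred_conj[OF drel_lt]] by simp
  next
    case 4
    then show ?thesis
      using definable_over_drel[OF dpred_conj[OF drel_rename[OF drel_lt, of 1 0] 4(2)]] by simp
  qed
next
  fix x y assume x: "x \<in> D" and y: "y \<in> dom M - D"
  show "\<exists>S\<in>B. x \<in> S \<and> y \<notin> S"
  proof (rule ccontr)
    assume "\<not> (\<exists>S\<in>B. x \<in> S \<and> y \<notin> S)"
    then have B: "y \<in> S" if "S \<in> B" "x \<in> S" for S using that by blast
    obtain P e where P: "dpred P" "range e \<subseteq> A" "D = {u \<in> dom M. P (e(0 := u))}"
      using D unfolding definable_over_def by blast
    have xM: "x \<in> dom M" and yM: "y \<in> dom M" using x y P(3) by auto
    have xA: "x \<notin> A"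
    proof
      assume "x \<in> A"
      then have "{x} \<in> B" unfolding B_def by blast
      then have "y = x" using B by blast
      then show False using x y by blast
    qed
    \<comment> \<open>Since no set separates them, \<open>y\<close> inherits the relations of
      \<open>x\<close> to the parameters below \<open>x\<close>, and likewise to those above
      it.\<close>
    have right: "Q c y" if "c \<in> A" "lt c x" "drel Q" "Q c x" for c Q
      using B[of "{t \<in> dom M. lt c t \<and> Q c t}"] that xM unfolding B_def by blast
    have left: "Q c y" if "c \<in> A" "lt x c" "drel Q" "Q c x" for c Q
      using B[of "{t \<in> dom M. lt t c \<and> Q c t}"] that xM unfolding B_def by blast
    define n where "n = card (insert x A)"
    obtain a where a: "a ` {1..n} = insert x A" "\<And>i. i \<in> {1..<n} \<Longrightarrow> lt (a i) (a (Suc i))"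
      using increasing_enumeration[of "insert x A"] A(1,2) xM unfolding n_def by auto
    have n: "2 \<le> n" using A(1,3) xA unfolding n_def
      by (metis One_nat_def Suc_1 Suc_leI Suc_le_mono card_gt_0_iff card_insert_disjoint)
    have aA: "a i \<in> insert x A" if "i \<in> {1..n}" for i using a(1) that by blast
    have "\<forall>v\<in>insert x A. \<exists>i\<in>{1..n}. a i = v" using a(1) by (metis imageE)
    then obtain ix where ix: "\<And>v. v \<in> insert x A \<Longrightarrow> ix v \<in> {1..n} \<and> a (ix v) = v" by metis
    \<comment> \<open>\<open>\<tau>\<close> reads the assignment \<open>e(0 := x)\<close> off the
      increasing enumeration, which turns \<open>P\<close> into a predicate of that tuple.\<close>
    define \<tau> where "\<tau> i = (if i = 0 then ix x else ix (e i))" for i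
    have eA: "e i \<in> A" for i using P(2) by auto
    have \<tau>: "\<tau> i \<in> {1..n}" "a (\<tau> i) = (e(0 := x)) i" for i
      using ix eA unfolding \<tau>_def by auto
    \<comment> \<open>Outside \<open>{1..n}\<close> the value \<open>x\<close> is a default that
      keeps the tuple in the domain; \<open>b\<close> is the same tuple with \<open>y\<close> in
      place of \<open>x\<close>.\<close>
    define a' where "a' i = (if i \<in> {1..n} then a i else x)" for i
    define b where "b i = (if a' i = x then y else a' i)" for i
    have a'A: "a' i \<in> insert x A" for i using aA unfolding a'_def by simp
    have "P (\<lambda>i. b (\<tau> i))"
    proof (rule binary[of n a' b "\<lambda>e. P (\<lambda>i. e (\<tau> i))"])
      have "a' i \<in> dom M" for i using a'A[of i] A(2) xM by auto
      then show "range a' \<subseteq> dom M" by blast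
      then show "range b \<subseteq> dom M" using yM unfolding b_def by auto
      show "dpred (\<lambda>e. P (\<lambda>i. e (\<tau> i)))" using dpred_rename[OF P(1)] .
      have "(\<lambda>i. a' (\<tau> i)) = e(0 := x)" using \<tau> unfolding a'_def by auto
      then show "P (\<lambda>i. a' (\<tau> i))" using x P(3) by simp
      fix e e' :: "nat \<Rightarrow> 'u" assume "\<And>i. i \<in> {1..n} \<Longrightarrow> e i = e' i"
      then show "P (\<lambda>i. e (\<tau> i)) \<longleftrightarrow> P (\<lambda>i. e' (\<tau> i))" using \<tau>(1) by simp
    next
      fix i assume i: "i \<in> {1..<n}"
      show lt_a': "lt (a' i) (a' (Suc i))" using a(2)[OF i] i unfolding a'_def by simp
      fix Q assume Q: "drel Q" "Q (a' i) (a' (Suc i))"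
      have "a' i \<noteq> a' (Suc i)" using lt_a' lt_irrefl a'A[of i] A(2) xM by auto
      \<comment> \<open>At most one member of a consecutive pair is \<open>x\<close>. Such pairs are
        covered by \<open>left\<close> and \<open>right\<close>; the others do not change.\<close>
      then consider "a' i = x" "a' (Suc i) \<in> A" "a' (Suc i) \<noteq> x"
        | "a' i \<in> A" "a' i \<noteq> x" "a' (Suc i) = x"
        | "a' i \<noteq> x" "a' (Suc i) \<noteq> x"
        using a'A[of i] a'A[of "Suc i"] by auto
      then show "Q (b i) (b (Suc i))"
      proof cases
        case 1
        then show ?thesis
          using left[OF 1(2) _ drel_rename[OF Q(1), of 1 0]] lt_a' Q(2) unfolding b_def by simp
      next
        case 2
        then show ?thesis using right[OF 2(1) _ Q(1)] lt_a' Q(2) unfolding b_def by simp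
      next
        case 3
        then show ?thesis using Q(2) unfolding b_def by simp
      qed
    qed (rule n)
    moreover have "(\<lambda>i. b (\<tau> i)) = e(0 := y)"
    proof
      fix i
      have "a' (\<tau> i) = (e(0 := x)) i" using \<tau> unfolding a'_def by simp
      then show "b (\<tau> i) = (e(0 := y)) i" using eA[of i] xA unfolding b_def by auto
    qed
    ultimately show False using y P(3) by simp
  qed
qed

text \<open>After the reduction to one parameter and one side of it, fibres above the parameter come
  from the finite cuts of \<open>lt\<close> and fibres below from those of the reversed
  order.\<close>

lemma definable_over_boolean_combination:
  assumes A: "finite A" "A \<subseteq> dom M" "A \<noteq> {}" and D: "definable_over A D"
    and G: "dom M \<in> G" "\<And>b. b \<in> dom M \<Longrightarrow> {x \<in> dom M. lt b x} \<in> G"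
      "\<And>b. b \<in> dom M \<Longrightarrow> {x \<in> dom M. lt x b} \<in> G"
      "\<And>R. definable_rel L M R \<Longrightarrow> almost_convex_equiv (dom M) lt R \<Longrightarrow> dom M // R \<subseteq> G"
  shows "D \<in> boolean_combinations (dom M) G"
proof (rule boolean_combinations_trans[OF one_parameter_boolean_combination[OF A D]])
  interpret rev: saturated_binary_order L M "\<lambda>x y. lt y x" by (rule reverse)
  \<comment> \<open>Convexity, and with it almost convexity, does not depend on the direction of the
    order.\<close>
  have convex_in_rev: "convex_in (dom M) (\<lambda>x y. lt y x) = convex_in (dom M) lt"
    unfolding convex_in_def by (intro ext) blast
  have almost_convex_rev:
    "almost_convex_equiv (dom M) (\<lambda>x y. lt y x) = almost_convex_equiv (dom M) lt"
    unfolding almost_convex_equiv_def convex_equiv_def convex_in_rev ..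
  have above: "{t \<in> dom M. lt a t \<and> Q a t} \<in> boolean_combinations (dom M) G"
    if "a \<in> dom M" "drel Q" for a Q
    using definable_fibre_boolean_combination[OF finite_cuts[OF that(2)] drel_lt that(2,1) G(1,2,4)] .
  have below: "{t \<in> dom M. lt t a \<and> Q a t} \<in> boolean_combinations (dom M) G"
    if "a \<in> dom M" "drel Q" for a Q
    by (rule definable_fibre_boolean_combination[OF rev.finite_cuts[OF that(2)] rev.drel_lt that(2,1)])
      (use G in \<open>auto simp: almost_convex_rev\<close>)
  have single: "{a} \<in> boolean_combinations (dom M) G" if "a \<in> dom M" for a
  proof -
    have "{a} = dom M - ({x \<in> dom M. lt a x} \<union> {x \<in> dom M. lt x a})"
      using that lt_cases lt_irrefl by blast
    then show ?thesis
      using boolean_combinations.compl[OF boolean_combinations.union[OF boolean_combinations.gen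
            boolean_combinations.gen], OF G(2)[OF that] G(3)[OF that]] by simp
  qed
  show "{dom M} \<union> {{a} | a. a \<in> A} \<union> {{t \<in> dom M. lt a t \<and> Q a t} | a Q. a \<in> A \<and> drel Q}
      \<union> {{t \<in> dom M. lt t a \<and> Q a t} | a Q. a \<in> A \<and> drel Q} \<subseteq> boolean_combinations (dom M) G"
    using single above below A(2) boolean_combinations.gen[OF G(1)] by blast
qed

end

section \<open>From the monster model to compactness and binarity\<close>

lemma saturated_compact:
  fixes M :: "('f, 'r, 'u) struct"
  assumes sat: "saturated L \<kappa> M" and card: "|formulas L| <o \<kappa>" and A: "finite A" "A \<subseteq> dom M"
    and F: "\<And>S. S \<in> F \<Longrightarrow> definability.definable_over L M A S"
      "\<And>Q. Q \<subseteq> F \<Longrightarrow> finite Q \<Longrightarrow> dom M \<inter> \<Inter>Q \<noteq> {}"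
  shows "dom M \<inter> \<Inter>F \<noteq> {}"
proof -
  interpret definability L M .
  have "\<forall>S\<in>F. \<exists>p. fst p \<in> formulas L \<and> range (snd p) \<subseteq> A \<and>
      S = {u \<in> dom M. sat M ((snd p)(0 := u)) (fst p)}"
  proof
    fix S assume S: "S \<in> F"
    obtain Q e where Q: "dpred Q" "range e \<subseteq> A" "S = {u \<in> dom M. Q (e(0 := u))}"
      using F(1)[OF S] unfolding definable_over_def by blast
    obtain \<phi> where \<phi>: "\<phi> \<in> formulas L" "\<forall>e. range e \<subseteq> dom M \<longrightarrow> (sat M e \<phi> \<longleftrightarrow> Q e)"
      using Q(1) unfolding dpred_def by blast
    have "range (e(0 := u)) \<subseteq> dom M" if "u \<in> dom M" for u
      using Q(2) A(2) that by (auto simp: fun_upd_def)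
    then have "S = {u \<in> dom M. sat M (e(0 := u)) \<phi>}" using Q(3) \<phi>(2) by blast
    then show "\<exists>p. fst p \<in> formulas L \<and> range (snd p) \<subseteq> A \<and>
        S = {u \<in> dom M. sat M ((snd p)(0 := u)) (fst p)}"
      using \<phi>(1) Q(2) by (intro exI[of _ "(\<phi>, e)"]) simp
  qed
  \<comment> \<open>One formula with parameters in \<open>A\<close> is chosen for each set; together
    they form a partial type over \<open>A\<close> whose finite parts are realized.\<close>
  from bchoice[OF this] obtain c where c: "\<forall>S\<in>F. fst (c S) \<in> formulas L \<and>
      range (snd (c S)) \<subseteq> A \<and> S = {u \<in> dom M. sat M ((snd (c S))(0 := u)) (fst (c S))}" ..
  have realizes: "realizes M u (c ` Q) \<longleftrightarrow> u \<in> dom M \<inter> \<Inter>Q" if "Q \<subseteq> F" for u Q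
  proof -
    have "sat M ((snd (c S))(0 := u)) (fst (c S)) \<longleftrightarrow> u \<in> S" if "S \<in> Q" "u \<in> dom M" for S
      using bspec[OF c, of S] that \<open>Q \<subseteq> F\<close> by blast
    then show ?thesis unfolding realizes_def by (auto simp: case_prod_beta)
  qed
  \<comment> \<open>The trivial equations, one for each variable, make the set of formulas infinite,
    so the finite set \<open>A\<close> is smaller than \<open>\<kappa>\<close>.\<close>
  have "inj (\<lambda>i. Eq (Var i) (Var i) :: ('f, 'r) fm)" by (simp add: inj_on_def)
  then have "infinite (range (\<lambda>i. Eq (Var i) (Var i) :: ('f, 'r) fm))"
    using finite_imageD infinite_UNIV_nat by blast
  moreover have "range (\<lambda>i. Eq (Var i) (Var i)) \<subseteq> formulas L" by (auto simp: formulas_def)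
  ultimately have "infinite (formulas L)" using finite_subset by blast
  then have "|A| <o |formulas L|" using A(1)
    by (intro finite_ordLess_infinite) (simp_all add: card_of_well_order_on Field_card_of)
  then have "|A| <o \<kappa>" using card ordLess_transitive by blast
  moreover have "c ` F \<subseteq> param_formulas L A"
  proof (rule image_subsetI)
    fix S assume "S \<in> F"
    then have "fst (c S) \<in> formulas L" "range (snd (c S)) \<subseteq> A" using c by blast+
    then show "c S \<in> param_formulas L A" unfolding param_formulas_def by (auto simp: case_prod_beta)
  qed
  moreover have "\<exists>u. realizes M u q" if q: "q \<subseteq> c ` F" "finite q" for q
  proof -
    obtain Q where Q: "Q \<subseteq> F" "finite Q" "q = c ` Q" using q by (meson finite_subset_image)
    then show ?thesis using realizes[OF Q(1)] F(2)[OF Q(1,2)] by blast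
  qed
  ultimately have "\<exists>u. realizes M u (c ` F)"
    using sat[unfolded saturated_def, THEN spec, THEN spec, of A "c ` F"] A(2) by blast
  then show ?thesis using realizes[of F] by blast
qed

text \<open>For \<open>binary\<close>, (LB) is used with the monster model both as the source of the
  types and as the model containing \<open>b\<close>.\<close>

lemma monster_saturated_binary_order:
  fixes L :: "('f, 'r) language" and U :: "('f, 'r, 'u) struct"
  assumes lt: "rels L lt = Some 2" and lin: "linear_order_theory TYPE('u) L lt T"
    and monster: "monster_model L T \<kappa> U" and LB: "LB TYPE('u) L lt T"
  shows "saturated_binary_order L U (less_in U lt)"
proof -
  interpret definability L U .
  have U: "model L T U" "saturated L \<kappa> U" "|formulas L| <o \<kappa>"
    using monster unfolding monster_model_def by auto
  show ?thesis
  proof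
    show "irreflp_on (dom U) (less_in U lt)" "transp_on (dom U) (less_in U lt)"
      "totalp_on (dom U) (less_in U lt)"
      using lin U(1) unfolding linear_order_theory_def by blast+
    show "drel (less_in U lt)"
      using lt unfolding dpred_def
      by (intro bexI[of _ "Rel lt [Var 0, Var 1]"]) (auto simp: formulas_def)
    show "dom U \<inter> \<Inter>F \<noteq> {}" if "finite A" "A \<subseteq> dom U" "\<And>S. S \<in> F \<Longrightarrow> definable_over A S"
      "\<And>Q. Q \<subseteq> F \<Longrightarrow> finite Q \<Longrightarrow> dom U \<inter> \<Inter>Q \<noteq> {}" for A F
      using saturated_compact[OF U(2,3) that] .
    fix n P and a b :: "nat \<Rightarrow> 'u"
    assume *: "2 \<le> n" "range a \<subseteq> dom U" "range b \<subseteq> dom U"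
      "\<And>i. i \<in> {1..<n} \<Longrightarrow> less_in U lt (a i) (a (Suc i))"
      "\<And>i Q. i \<in> {1..<n} \<Longrightarrow> drel Q \<Longrightarrow> Q (a i) (a (Suc i)) \<Longrightarrow> Q (b i) (b (Suc i))"
      "dpred P" "\<And>e e'. (\<And>i. i \<in> {1..n} \<Longrightarrow> e i = e' i) \<Longrightarrow> P e \<longleftrightarrow> P e'" "P a"
    obtain \<phi> where \<phi>: "\<phi> \<in> formulas L" "fv \<phi> \<subseteq> {1..n}"
      "\<And>e. range e \<subseteq> dom U \<Longrightarrow> sat U e \<phi> \<longleftrightarrow> P e"
    proof (rule dpred_supported[OF *(6), of "{1..n}"])
      show "P e \<longleftrightarrow> P e'" if "\<And>i. i \<in> {1..n} \<Longrightarrow> e i = e' i" for e e'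
        using that by (rule *(7))
      show "{1..n} \<noteq> {}" using *(1) by simp
    qed (use that in blast)
    have "entails TYPE('u) L T (\<Union>i\<in>{1..<n}. tp L U {i, Suc i} a) (tp L U {1..n} a)"
      using LB U(1) *(1,2,4) unfolding LB_def by blast
    moreover have "sat U b \<psi>" if "\<psi> \<in> (\<Union>i\<in>{1..<n}. tp L U {i, Suc i} a)" for \<psi>
    proof -
      obtain i where i: "i \<in> {1..<n}" "\<psi> \<in> formulas L" "fv \<psi> \<subseteq> {i, Suc i}" "sat U a \<psi>"
        using \<open>\<psi> \<in> _\<close> unfolding tp_def by blast
      \<comment> \<open>The formula in the variables \<open>i\<close> and \<open>Suc i\<close> is
        read as a binary relation, so that the hypothesis on consecutive pairs applies.\<close>
      define Q where "Q x y \<longleftrightarrow> sat U (\<lambda>k. if k = i then x else y) \<psi>" for x y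
      have Q: "sat U c \<psi> \<longleftrightarrow> Q (c i) (c (Suc i))" for c
        unfolding Q_def using i(3) by (intro sat_cong) auto
      have "drel Q"
        using dpred_rename[OF dpred_sat[OF i(2)], of "\<lambda>k. if k = i then 0 else 1"]
        unfolding Q_def by (simp add: if_distrib)
      then show ?thesis using *(5)[OF i(1)] i(4) Q by blast
    qed
    moreover have "\<phi> \<in> tp L U {1..n} a" using \<phi> *(2,8) unfolding tp_def by blast
    ultimately have "sat U b \<phi>" using U(1) *(3) unfolding entails_def by blast
    then show "P b" using \<phi>(3) *(3) by blast
  qed
qed

theorem theorem4p7:
  fixes L :: "('f, 'r) language"
    and lt :: 'r
    and T :: "('f, 'r) fm set"
    and \<kappa> :: "'k rel"
    and U :: "('f, 'r, 'u) struct"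
    and D :: "'u set"
  assumes "rels L lt = Some 2"
    and "complete_theory TYPE('u) L T"
    and "\<exists>M :: ('f, 'r, 'u) struct. model L T M \<and> infinite (dom M)"
    and "linear_order_theory TYPE('u) L lt T"
    and "monster_model L T \<kappa> U"
    and "LB TYPE('u) L lt T"
    and "param_definable_set L U D"
  shows "D \<in> boolean_combinations (dom U)
               (intervals (dom U) (less_in U lt) \<union> definable_almost_convex_classes L lt U)"
proof -
  interpret saturated_binary_order L U "less_in U lt"
    using monster_saturated_binary_order[OF assms(1,4,5,6)] .
  let ?G = "intervals (dom U) (less_in U lt) \<union> definable_almost_convex_classes L lt U"
  have "dom U \<noteq> {}"
    using assms(5) unfolding monster_model_def model_def is_struct_def by blast
  then obtain c where c: "c \<in> dom U" by blast
  obtain \<phi> e where \<phi>: "\<phi> \<in> formulas L" "e ` (fv \<phi> - {0}) \<subseteq> dom U"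
    "D = {u \<in> dom U. sat U (e(0 := u)) \<phi>}"
    using assms(7) unfolding param_definable_set_def param_formulas_def by auto
  define A where "A = insert c (e ` (fv \<phi> - {0}))"
  \<comment> \<open>Only the values of \<open>e\<close> at the free variables other than 0 are known
    to lie in the domain; all others are reset to \<open>c\<close>, which also makes
    \<open>A\<close> nonempty.\<close>
  define d where "d i = (if i \<in> fv \<phi> - {0} then e i else c)" for i
  have "sat U (e(0 := u)) \<phi> \<longleftrightarrow> sat U (d(0 := u)) \<phi>" for u
    unfolding d_def by (intro sat_cong) auto
  then have D: "definable_over A D"
    unfolding definable_over_def \<phi>(3)
    by (intro exI[of _ "\<lambda>e. sat U e \<phi>"] exI[of _ d])
      (auto simp: A_def d_def intro: dpred_sat[OF \<phi>(1)])
  have A: "finite A" "A \<subseteq> dom U" "A \<noteq> {}"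
    using c \<phi>(2) finite_fv[of \<phi>] unfolding A_def by auto
  \<comment> \<open>The whole domain is both an upward and a downward ray, so each ray is an
    interval.\<close>
  have rays: "R \<in> ?G"
    if "R \<in> upward_rays (dom U) (less_in U lt) \<or> R \<in> downward_rays (dom U) (less_in U lt)" for R
  proof -
    have "dom U \<in> upward_rays (dom U) (less_in U lt)" "dom U \<in> downward_rays (dom U) (less_in U lt)"
      unfolding upward_rays_def downward_rays_def by auto
    moreover have "R \<subseteq> dom U" using that unfolding upward_rays_def downward_rays_def by auto
    then have "R = R \<inter> dom U" "R = dom U \<inter> R" by auto
    ultimately show ?thesis using that unfolding intervals_def by blast
  qed
  show ?thesis
  proof (rule definable_over_boolean_combination[OF A D])
    show "dom U \<in> ?G" by (rule rays) (simp add: upward_rays_def)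
    show "{x \<in> dom U. less_in U lt b x} \<in> ?G" if "b \<in> dom U" for b
      by (rule rays) (use that in \<open>auto simp: upward_rays_def\<close>)
    show "{x \<in> dom U. less_in U lt x b} \<in> ?G" if "b \<in> dom U" for b
      by (rule rays) (use that in \<open>auto simp: downward_rays_def\<close>)
    show "dom U // R \<subseteq> ?G"
      if "definable_rel L U R" "almost_convex_equiv (dom U) (less_in U lt) R" for R
      using that unfolding definable_almost_convex_classes_def by blast
  qed
qed

end
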